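(* Let $D^n_t$ be the distance at time $t$ from the starting point of the continuous time random adjacent transposition walk on $n$ markers. Let $s=s(n)>0$ satisfy $s(n)\to\infty$ and $s(n)/n^2\to 0$ as $n\to\infty$. Then $$\frac{1}{n\sqrt{s}}\,D^n_{ns}\to\sqrt{\frac{2}{\pi}}\quad\text{in probability as } n\to\infty.$$
   Context: Random adjacent transposition walk on $n$ markers: the state at time $t$ is a permutation $X^n_t$ of $\{1,\dots,n\}$, where $X^n_t(j)$ is the location of particle $j$, and $X^n_0$ is the identity. At rate $1$, one picks $i\in\{1,\dots,n-1\}$ uniformly at random and exchanges the particles at locations $i$ and $i+1$. $D^n_t$ is the minimal number of adjacent transpositions needed to build $X^n_t$ from the identity; equivalently $D^n_t=\#\{1\le i<j\le n: X^n_t(i)>X^n_t(j)\}$, the number of inversions. *)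

theory Defs
  imports "HOL-Probability.Probability" "HOL-Combinatorics.Transposition"
begin

text \<open>
  A configuration is a function \<open>\<sigma>\<close> with \<open>\<sigma> j\<close> the location of particle \<open>j\<close>; on \<open>n\<close> markers,
  both particles and locations are \<open>{1..n}\<close>, and \<open>\<sigma>\<close> is the identity elsewhere. Exchanging the
  particles at locations \<open>i\<close> and \<open>i + 1\<close> therefore composes with the transposition on the left.
\<close>

definition adj_swap :: "nat \<Rightarrow> (nat \<Rightarrow> nat) \<Rightarrow> (nat \<Rightarrow> nat)" where
  "adj_swap i \<sigma> = Transposition.transpose i (Suc i) \<circ> \<sigma>"

definition adj_swaps :: "nat list \<Rightarrow> (nat \<Rightarrow> nat)" where
  "adj_swaps ks = fold adj_swap ks id"

definition adj_dist :: "nat \<Rightarrow> (nat \<Rightarrow> nat) \<Rightarrow> nat" where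
  "adj_dist n \<sigma> = (LEAST m. \<exists>ks. length ks = m \<and> set ks \<subseteq> {1..<n} \<and> adj_swaps ks = \<sigma>)"

text \<open>
  The walk is driven by a rate 1 Poisson clock with holding times \<open>E 0, E 1, \<dots>\<close>; at the \<open>k\<close>-th
  ring, counting from 0, the particles at locations \<open>I k\<close> and \<open>I k + 1\<close> are exchanged.
  All the variables \<open>E k\<close> and \<open>I k\<close> are jointly independent; the locations are embedded into the
  reals there only because \<open>indep_vars\<close> needs a common value type.
\<close>

locale adjacent_transposition_clock = prob_space M
  for M :: "'a measure" +
  fixes n :: nat
    and E :: "nat \<Rightarrow> 'a \<Rightarrow> real"
    and I :: "nat \<Rightarrow> 'a \<Rightarrow> nat"
  assumes n_ge_2: "2 \<le> n"
    and holding_time: "\<And>k. distributed M lborel (E k) (exponential_density 1)"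
    and location_measurable: "\<And>k. random_variable (count_space UNIV) (I k)"
    and location_uniform: "\<And>k. distr M (count_space UNIV) (I k) = measure_pmf (pmf_of_set {1..<n})"
    and indep_clock: "indep_vars (\<lambda>_. borel) (case_sum E (\<lambda>k \<omega>. real (I k \<omega>))) UNIV"

text \<open>
  The set of rings up to time \<open>t\<close> is almost surely finite; on the exceptional null set the
  value of \<open>card\<close> is irrelevant.
\<close>

definition clock_rings :: "(nat \<Rightarrow> 'a \<Rightarrow> real) \<Rightarrow> real \<Rightarrow> 'a \<Rightarrow> nat" where
  "clock_rings E t \<omega> = card {k. (\<Sum>j\<le>k. E j \<omega>) \<le> t}"

definition transposition_walk ::
    "(nat \<Rightarrow> 'a \<Rightarrow> real) \<Rightarrow> (nat \<Rightarrow> 'a \<Rightarrow> nat) \<Rightarrow> real \<Rightarrow> 'a \<Rightarrow> (nat \<Rightarrow> nat)" where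
  "transposition_walk E I t \<omega> = adj_swaps (map (\<lambda>k. I k \<omega>) [0..<clock_rings E t \<omega>])"

definition walk_distance ::
    "nat \<Rightarrow> (nat \<Rightarrow> 'a \<Rightarrow> real) \<Rightarrow> (nat \<Rightarrow> 'a \<Rightarrow> nat) \<Rightarrow> real \<Rightarrow> 'a \<Rightarrow> nat" where
  "walk_distance n E I t \<omega> = adj_dist n (transposition_walk E I t \<omega>)"

definition tendsto_in_probability ::
    "(nat \<Rightarrow> 'a measure) \<Rightarrow> (nat \<Rightarrow> 'a \<Rightarrow> real) \<Rightarrow> real \<Rightarrow> bool" where
  "tendsto_in_probability M Y c \<longleftrightarrow>
     (\<forall>\<epsilon>>0. (\<lambda>n. measure (M n) {\<omega> \<in> space (M n). \<bar>Y n \<omega> - c\<bar> > \<epsilon>}) \<longlonglongrightarrow> 0)"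

end

theory Submission
  imports Defs "HOL-Real_Asymp.Real_Asymp"
begin

text \<open>
  The distance is the number of inversions, which changes by at most one per ring. Hence the
  Poisson number of rings may be replaced by its mean up to an error of order
  \<open>\<surd>(n s)\<close>, which is negligible against \<open>n \<surd>s\<close>, and only the walk after a deterministic
  number \<open>m\<close> of swaps matters.

  Mean: the order of two markers changes sign exactly as a simple random walk on the integers that
  passes through \<open>0\<close> (by oddness of the sign, one flip of an adjacent pair amounts to two
  steps towards \<open>0\<close>); the two ends of the segment contribute an error of order \<open>m / n\<close> in
  total. Summing by parts over all pairs turns the expected number of inversions into
  \<open>n / 2\<close> times the mean absolute value of a lazy random walk, evaluated by Wallis' product.

  Variance: let \<open>h(x, y)\<close> be the expected sign of \<open>Y - X\<close> after \<open>k\<close> more swaps for markers started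
  at \<open>x\<close> and \<open>y\<close>. It is decreasing in \<open>x\<close>, so that \<open>\<Sum>y. \<bar>h(x, y) - h(x + 1, y)\<bar>\<close> telescopes into a
  difference of one-particle means, which is at most \<open>2\<close>. Hence the Doob martingale of the number
  of inversions has bounded increments and the variance is \<open>O(m)\<close>, against \<open>n\<^sup>2 s\<close>.
\<close>

section \<open>The lazy random walk on the integers\<close>

text \<open>This is the mean of \<open>f\<close> at the end of \<open>k\<close> independent steps
  from \<open>z\<close>, each \<open>+1\<close> or \<open>-1\<close> with probability
  \<open>\<theta> / 2\<close> and \<open>0\<close> otherwise. As a plain recursion on functions it
  can be compared term by term with the swap recursion \<open>pair_order\<close>, without any
  probability space.\<close>

fun lazy_walk :: "real \<Rightarrow> nat \<Rightarrow> (int \<Rightarrow> real) \<Rightarrow> int \<Rightarrow> real" where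
  "lazy_walk \<theta> 0 f z = f z"
| "lazy_walk \<theta> (Suc k) f z =
     (1 - \<theta>) * lazy_walk \<theta> k f z + \<theta> * ((lazy_walk \<theta> k f (z + 1) + lazy_walk \<theta> k f (z - 1)) / 2)"

lemma lazy_walk_shift: "lazy_walk \<theta> k (\<lambda>z. f (z + c)) z = lazy_walk \<theta> k f (z + c)"
proof (induction k arbitrary: z)
  case (Suc k)
  show ?case using Suc[of z] Suc[of "z + 1"] Suc[of "z - 1"] by (simp add: algebra_simps)
qed simp

lemma lazy_walk_linear:
  "lazy_walk \<theta> k (\<lambda>z. a * f z + b * g z) z = a * lazy_walk \<theta> k f z + b * lazy_walk \<theta> k g z"
  by (induction k arbitrary: z) (simp_all add: field_simps)

lemma lazy_walk_diff:
  "lazy_walk \<theta> k (\<lambda>z. f z - g z) z = lazy_walk \<theta> k f z - lazy_walk \<theta> k g z"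
  using lazy_walk_linear[of \<theta> k 1 f "-1" g z] by simp

text \<open>The definition splits off the first step, this splits off the last one. It lets a
  one-step identity for \<open>f\<close> be inserted at the end of the walk.\<close>

lemma lazy_walk_Suc':
  "lazy_walk \<theta> (Suc k) f z = lazy_walk \<theta> k (lazy_walk \<theta> 1 f) z"
proof (induction k arbitrary: z)
  case (Suc k)
  show ?case
    by (simp only: lazy_walk.simps(2)[of \<theta> "Suc k" f z] Suc.IH
        lazy_walk.simps(2)[of \<theta> k "lazy_walk \<theta> 1 f" z])
qed simp

lemma lazy_walk_odd:
  assumes "\<And>z. f (- z) = - f z"
  shows "lazy_walk \<theta> k f (- z) = - lazy_walk \<theta> k f z"
proof (induction k arbitrary: z)
  case (Suc k)
  have "lazy_walk \<theta> k f (- z + 1) = - lazy_walk \<theta> k f (z - 1)"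
    "lazy_walk \<theta> k f (- z - 1) = - lazy_walk \<theta> k f (z + 1)"
    using Suc[of "z - 1"] Suc[of "z + 1"] by simp_all
  then show ?case using Suc[of z] by (simp add: field_simps)
qed (simp add: assms)

lemma lazy_walk_nonneg:
  assumes "0 \<le> \<theta>" "\<theta> \<le> 1" "\<And>z. 0 \<le> f z"
  shows "0 \<le> lazy_walk \<theta> k f z"
  using assms by (induction k arbitrary: z) (simp_all add: add_nonneg_nonneg)

text \<open>One step is a convex combination of translates, and translation keeps the l1 norm.
  Bounding every finite partial sum by the same \<open>C\<close> takes the place of summability over
  all integers.\<close>

lemma lazy_walk_l1_bound:
  assumes \<theta>: "0 \<le> \<theta>" "\<theta> \<le> 1" and f: "\<And>Z. finite Z \<Longrightarrow> (\<Sum>z\<in>Z. \<bar>f z\<bar>) \<le> C"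
    and "finite Z"
  shows "(\<Sum>z\<in>Z. \<bar>lazy_walk \<theta> k f z\<bar>) \<le> C"
  using \<open>finite Z\<close>
proof (induction k arbitrary: Z)
  case 0
  then show ?case using f by simp
next
  case (Suc k)
  let ?w = "lazy_walk \<theta> k f"
  have sh: "(\<Sum>z\<in>Z. \<bar>?w (z + c)\<bar>) \<le> C" for c
  proof -
    have "(\<Sum>z\<in>Z. \<bar>?w (z + c)\<bar>) = (\<Sum>z\<in>(\<lambda>z. z + c) ` Z. \<bar>?w z\<bar>)"
      by (subst sum.reindex) (auto simp: inj_on_def)
    then show ?thesis using Suc by simp
  qed
  have "\<bar>lazy_walk \<theta> (Suc k) f z\<bar> \<le> (1 - \<theta>) * \<bar>?w z\<bar> + \<theta> / 2 * \<bar>?w (z + 1)\<bar> + \<theta> / 2 * \<bar>?w (z + - 1)\<bar>" for z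
  proof -
    have "\<bar>lazy_walk \<theta> (Suc k) f z\<bar> = \<bar>(1 - \<theta>) * ?w z + \<theta> / 2 * ?w (z + 1) + \<theta> / 2 * ?w (z + - 1)\<bar>"
      by (simp add: field_simps)
    also have "\<dots> \<le> \<bar>(1 - \<theta>) * ?w z\<bar> + \<bar>\<theta> / 2 * ?w (z + 1)\<bar> + \<bar>\<theta> / 2 * ?w (z + - 1)\<bar>"
      by linarith
    finally show ?thesis using \<theta> by (simp add: abs_mult)
  qed
  then have "(\<Sum>z\<in>Z. \<bar>lazy_walk \<theta> (Suc k) f z\<bar>) \<le>
      (\<Sum>z\<in>Z. (1 - \<theta>) * \<bar>?w z\<bar> + \<theta> / 2 * \<bar>?w (z + 1)\<bar> + \<theta> / 2 * \<bar>?w (z + - 1)\<bar>)"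
    by (intro sum_mono)
  also have "\<dots> = (1 - \<theta>) * (\<Sum>z\<in>Z. \<bar>?w z\<bar>) + \<theta> / 2 * (\<Sum>z\<in>Z. \<bar>?w (z + 1)\<bar>)
      + \<theta> / 2 * (\<Sum>z\<in>Z. \<bar>?w (z + - 1)\<bar>)"
    by (simp only: sum.distrib sum_distrib_left)
  also have "\<dots> \<le> (1 - \<theta>) * C + \<theta> / 2 * C + \<theta> / 2 * C"
    using sh[of 0] sh[of 1] sh[of "-1"] \<theta> by (intro add_mono mult_left_mono) auto
  also have "\<dots> = C" by (simp add: field_simps)
  finally show ?case .
qed

section \<open>Expected sign, expected absolute value and occupation of 0 for the lazy walk\<close>

definition walk_sgn :: "real \<Rightarrow> nat \<Rightarrow> int \<Rightarrow> real" where
  "walk_sgn \<theta> k = lazy_walk \<theta> k (\<lambda>z. of_int (sgn z))"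

definition walk_abs :: "real \<Rightarrow> nat \<Rightarrow> int \<Rightarrow> real" where
  "walk_abs \<theta> k = lazy_walk \<theta> k (\<lambda>z. of_int \<bar>z\<bar>)"

definition walk_at_zero :: "real \<Rightarrow> nat \<Rightarrow> int \<Rightarrow> real" where
  "walk_at_zero \<theta> k = lazy_walk \<theta> k (\<lambda>z. of_bool (z = 0))"

lemma walk_sgn_odd: "walk_sgn \<theta> k (- z) = - walk_sgn \<theta> k z"
  unfolding walk_sgn_def by (rule lazy_walk_odd) simp

text \<open>The walk commutes with differences, and the forward difference of the sign is the
  indicator of \<open>{-1, 0}\<close>, of total mass 2. The l1 contraction preserves this mass
  bound.\<close>

lemma walk_sgn_variation:
  assumes "0 \<le> \<theta>" "\<theta> \<le> 1" "finite Z"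
  shows "(\<Sum>z\<in>Z. \<bar>walk_sgn \<theta> k (z + 1) - walk_sgn \<theta> k z\<bar>) \<le> 2"
proof -
  let ?f = "\<lambda>z::int. real_of_int (sgn (z + 1)) - of_int (sgn z)"
  have eq: "walk_sgn \<theta> k (z + 1) - walk_sgn \<theta> k z = lazy_walk \<theta> k ?f z" for z
    unfolding walk_sgn_def by (simp add: lazy_walk_diff lazy_walk_shift[where f="\<lambda>z. real_of_int (sgn z)"])
  have "(\<Sum>z\<in>Z. \<bar>?f z\<bar>) \<le> 2" if "finite Z" for Z
  proof -
    have "(\<Sum>z\<in>Z. \<bar>?f z\<bar>) \<le> (\<Sum>z\<in>Z. of_bool (z \<in> {-1, 0}))"
      by (intro sum_mono) (auto simp: sgn_if)
    also have "\<dots> = card (Z \<inter> {-1, 0})" using that by (simp add: sum_of_bool_eq del: insert_iff)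
    also have "\<dots> \<le> card {-1::int, 0}" by (intro of_nat_mono card_mono) auto
    finally show ?thesis by simp
  qed
  then show ?thesis using lazy_walk_l1_bound[OF assms(1,2) _ assms(3), of ?f 2 k] eq by simp
qed

lemma walk_at_zero_sum:
  assumes "0 \<le> \<theta>" "\<theta> \<le> 1" "finite Z"
  shows "(\<Sum>z\<in>Z. walk_at_zero \<theta> k z) \<le> 1"
proof -
  have "(\<Sum>z\<in>Z. \<bar>of_bool (z = (0::int))::real\<bar>) \<le> 1" if "finite Z" for Z
  proof -
    have "(\<Sum>z\<in>Z. \<bar>of_bool (z = (0::int))::real\<bar>) = card (Z \<inter> {0})" using that
      by (simp add: sum_of_bool_eq)
    also have "\<dots> \<le> card {0::int}" by (intro of_nat_mono card_mono) auto
    finally show ?thesis by simp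
  qed
  from lazy_walk_l1_bound[OF assms(1,2) this assms(3), of k]
  have "(\<Sum>z\<in>Z. \<bar>walk_at_zero \<theta> k z\<bar>) \<le> 1" by (simp add: walk_at_zero_def)
  moreover have "(\<Sum>z\<in>Z. walk_at_zero \<theta> k z) \<le> (\<Sum>z\<in>Z. \<bar>walk_at_zero \<theta> k z\<bar>)"
    by (intro sum_mono) simp
  ultimately show ?thesis by simp
qed

lemma walk_at_zero_nonneg:
  assumes "0 \<le> \<theta>" "\<theta> \<le> 1"
  shows "0 \<le> walk_at_zero \<theta> k z"
  unfolding walk_at_zero_def using assms by (intro lazy_walk_nonneg) auto

text \<open>Discrete Tanaka formula: the absolute value is harmonic away from 0, and at 0 one step
  raises its mean by \<open>\<theta>\<close>.\<close>

lemma walk_abs_Suc: "walk_abs \<theta> (Suc k) z = walk_abs \<theta> k z + \<theta> * walk_at_zero \<theta> k z"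
proof -
  have "lazy_walk \<theta> 1 (\<lambda>z. of_int \<bar>z\<bar>) = (\<lambda>z. 1 * of_int \<bar>z\<bar> + \<theta> * of_bool (z = 0))"
  proof
    fix z :: int
    consider "z = 0" | "z \<ge> 1" | "z \<le> -1" by linarith
    then show "lazy_walk \<theta> 1 (\<lambda>z. of_int \<bar>z\<bar>) z = 1 * of_int \<bar>z\<bar> + \<theta> * of_bool (z = 0)"
      by cases (auto simp: field_simps)
  qed
  then show ?thesis
    unfolding walk_abs_def walk_at_zero_def lazy_walk_Suc'
    using lazy_walk_linear[of \<theta> k 1 "\<lambda>z. of_int \<bar>z\<bar>" \<theta> "\<lambda>z. of_bool (z = 0)" z] by simp
qed

lemma walk_abs_eq: "walk_abs \<theta> m z = of_int \<bar>z\<bar> + \<theta> * (\<Sum>k<m. walk_at_zero \<theta> k z)"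
  by (induction m) (simp_all add: walk_abs_Suc field_simps, simp add: walk_abs_def)

lemma walk_sgn_eq_diff: "walk_sgn \<theta> k z = (walk_abs \<theta> k (z + 1) - walk_abs \<theta> k (z - 1)) / 2"
proof -
  have "real_of_int (sgn z) = (1/2) * of_int \<bar>z + 1\<bar> + (-(1/2)) * of_int \<bar>z + - 1\<bar>" for z :: int
    by (auto simp: sgn_if field_simps)
  then have "walk_sgn \<theta> k z = lazy_walk \<theta> k (\<lambda>z. (1/2) * of_int \<bar>z + 1\<bar> + (-(1/2)) * of_int \<bar>z + - 1\<bar>) z"
    by (simp add: walk_sgn_def)
  also have "\<dots> = (1/2) * walk_abs \<theta> k (z + 1) + (-(1/2)) * walk_abs \<theta> k (z + - 1)"
    unfolding lazy_walk_linear walk_abs_def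
    by (simp only: lazy_walk_shift[where f="\<lambda>z. real_of_int \<bar>z\<bar>"])
  finally show ?thesis by simp
qed

lemma walk_abs_lipschitz:
  assumes "0 \<le> \<theta>" "\<theta> \<le> 1"
  shows "\<bar>walk_abs \<theta> k (z + 1) - walk_abs \<theta> k z\<bar> \<le> 1"
proof (induction k arbitrary: z)
  case 0
  show ?case by (simp add: walk_abs_def)
next
  case (Suc k)
  let ?d = "\<lambda>z. walk_abs \<theta> k (z + 1) - walk_abs \<theta> k z"
  have *: "walk_abs \<theta> (Suc k) (z + 1) - walk_abs \<theta> (Suc k) z
     = (1 - \<theta>) * ?d z + \<theta> / 2 * ?d (z + 1) + \<theta> / 2 * ?d (z - 1)"
    by (simp add: walk_abs_def field_simps)
  have "\<bar>\<dots>\<bar> \<le> \<bar>(1 - \<theta>) * ?d z\<bar> + \<bar>\<theta> / 2 * ?d (z + 1)\<bar> + \<bar>\<theta> / 2 * ?d (z - 1)\<bar>" by linarith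
  also have "\<dots> = (1 - \<theta>) * \<bar>?d z\<bar> + \<theta> / 2 * \<bar>?d (z + 1)\<bar> + \<theta> / 2 * \<bar>?d (z - 1)\<bar>"
    using assms by (simp add: abs_mult)
  also have "\<dots> \<le> (1 - \<theta>) * 1 + \<theta> / 2 * 1 + \<theta> / 2 * 1"
    using assms Suc[of z] Suc[of "z+1"] Suc[of "z-1"] by (intro add_mono mult_left_mono) auto
  finally show ?case using * by simp
qed

text \<open>The weight \<open>n - z\<close> is the number of marker pairs at initial distance
  \<open>z\<close>. If \<open>r\<close> is the excess of the mean absolute value over
  \<open>z\<close>, then \<open>1 - walk_sgn\<close> is a centred difference of \<open>r\<close>.
  Summation by parts leaves \<open>n * r 0\<close> as main term, with errors governed by the total
  mass of \<open>r\<close> and by \<open>r 1 - r 0\<close>.\<close>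

lemma sum_weighted_walk_sgn:
  assumes \<theta>: "0 \<le> \<theta>" "\<theta> \<le> 1" and n: "1 \<le> n"
  shows "\<bar>(\<Sum>z = 1..<n. (real n - real z) * (1 - walk_sgn \<theta> m (int z))) - real n * walk_abs \<theta> m 0\<bar>
    \<le> real n + 2 * (\<theta> * real m)"
proof -
  define r where "r z = walk_abs \<theta> m (int z) - real z" for z
  have r_eq: "r z = \<theta> * (\<Sum>k<m. walk_at_zero \<theta> k (int z))" for z
    by (simp add: r_def walk_abs_eq)
  have r_nonneg: "0 \<le> r z" for z
    unfolding r_eq using \<theta> by (intro mult_nonneg_nonneg sum_nonneg walk_at_zero_nonneg) auto
  \<comment> \<open>Each time \<open>k\<close> contributes at most \<open>\<theta>\<close>, because
    the probabilities of being at 0, summed over the starting points, are at most 1.\<close>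
  have r_sum: "(\<Sum>z\<in>Z. r z) \<le> \<theta> * real m" if "finite Z" for Z
  proof -
    have "(\<Sum>z\<in>Z. r z) = \<theta> * (\<Sum>k<m. \<Sum>z\<in>Z. walk_at_zero \<theta> k (int z))"
      unfolding r_eq by (subst sum.swap) (simp add: sum_distrib_left)
    also have "\<dots> = \<theta> * (\<Sum>k<m. \<Sum>z\<in>int ` Z. walk_at_zero \<theta> k z)"
      by (subst sum.reindex) (auto simp: inj_on_def)
    also have "\<dots> \<le> \<theta> * (\<Sum>k<m. 1)"
      using \<theta> that by (intro mult_left_mono sum_mono walk_at_zero_sum) auto
    finally show ?thesis by simp
  qed
  have r01: "\<bar>r 1 - r 0\<bar> \<le> 2"
    using walk_abs_lipschitz[OF \<theta>, of m 0] by (simp add: r_def)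
  have diff: "1 - walk_sgn \<theta> m (int z) = (r (z - 1) - r (z + 1)) / 2" if "1 \<le> z" for z
    using that by (simp add: walk_sgn_eq_diff r_def of_nat_diff add.commute field_simps)
  have tele: "(\<Sum>z = 1..<Suc k. (r (z - 1) - r (z + 1)) / 2) = (r 0 + r 1 - r k - r (Suc k)) / 2" for k
    by (induction k) (simp_all add: field_simps)
  \<comment> \<open>Raising \<open>k\<close> by one raises every weight by one, which adds a single
    copy of the telescoping sum \<open>tele\<close>.\<close>
  have abel: "(\<Sum>z = 1..<Suc k. (real (Suc k) - real z) * ((r (z - 1) - r (z + 1)) / 2)) =
      (\<Sum>j = 1..<Suc k. (r 0 + r 1 - r j - r (Suc j)) / 2)" for k
  proof (induction k)
    case (Suc k)
    have "(\<Sum>z = 1..<Suc (Suc k). (real (Suc (Suc k)) - real z) * ((r (z - 1) - r (z + 1)) / 2))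
      = (\<Sum>z = 1..<Suc (Suc k). (real (Suc k) - real z) * ((r (z - 1) - r (z + 1)) / 2))
        + (\<Sum>z = 1..<Suc (Suc k). (r (z - 1) - r (z + 1)) / 2)"
      by (subst sum.distrib[symmetric]) (intro sum.cong refl, simp add: field_simps)
    also have "(\<Sum>z = 1..<Suc (Suc k). (real (Suc k) - real z) * ((r (z - 1) - r (z + 1)) / 2))
      = (\<Sum>z = 1..<Suc k. (real (Suc k) - real z) * ((r (z - 1) - r (z + 1)) / 2))"
      by simp
    finally show ?case using Suc tele[of "Suc k"] by simp
  qed simp
  obtain k where k: "n = Suc k" using n by (cases n) auto
  have "(\<Sum>z = 1..<n. (real n - real z) * (1 - walk_sgn \<theta> m (int z)))
      = (\<Sum>z = 1..<Suc k. (real (Suc k) - real z) * ((r (z - 1) - r (z + 1)) / 2))"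
    unfolding k by (intro sum.cong refl) (simp add: diff)
  also have "\<dots> = (\<Sum>j = 1..<Suc k. (r 0 + r 1) / 2 - r j / 2 - r (Suc j) / 2)"
    unfolding abel by (intro sum.cong refl) (simp add: field_simps)
  also have "\<dots> = real k * (r 0 + r 1) / 2 - (\<Sum>j = 1..<Suc k. r j) / 2 - (\<Sum>j = 1..<Suc k. r (Suc j)) / 2"
    by (simp only: sum_subtractf sum_divide_distrib[symmetric] sum_constant) simp
  also have "(\<Sum>j = 1..<Suc k. r (Suc j)) = (\<Sum>j\<in>Suc ` {1..<Suc k}. r j)"
    by (subst sum.reindex) auto
  finally have S: "(\<Sum>z = 1..<n. (real n - real z) * (1 - walk_sgn \<theta> m (int z))) =
    real k * (r 0 + r 1) / 2 - (\<Sum>j = 1..<Suc k. r j) / 2 - (\<Sum>j\<in>Suc ` {1..<Suc k}. r j) / 2" .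
  have u0: "walk_abs \<theta> m 0 = r 0" by (simp add: r_def)
  have "0 \<le> (\<Sum>j = 1..<Suc k. r j)" "0 \<le> (\<Sum>j\<in>Suc ` {1..<Suc k}. r j)"
    by (intro sum_nonneg r_nonneg)+
  moreover have "(\<Sum>j = 1..<Suc k. r j) \<le> \<theta> * real m" "(\<Sum>j\<in>Suc ` {1..<Suc k}. r j) \<le> \<theta> * real m"
      "r 0 \<le> \<theta> * real m"
    using r_sum[of "{1..<Suc k}"] r_sum[of "Suc ` {1..<Suc k}"] r_sum[of "{0}"] by auto
  moreover have "\<bar>real k * (r 1 - r 0) / 2\<bar> \<le> real k"
    using mult_left_mono[OF r01, of "real k"] by (simp add: abs_mult)
  moreover have "real k * (r 0 + r 1) / 2 = real n * r 0 + real k * (r 1 - r 0) / 2 - r 0"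
    by (simp add: k field_simps)
  ultimately show ?thesis unfolding S unfolding u0 k using r_nonneg[of 0] by linarith
qed

section \<open>Mean absolute value: mixing over the binomial number of moves, and Wallis'
  product\<close>

lemma lazy_walk_eq_Bernstein:
  "lazy_walk \<theta> m f z = (\<Sum>j\<le>m. Bernstein m j \<theta> * lazy_walk 1 j f z)"
proof (induction m arbitrary: z)
  case 0
  show ?case by (simp add: Bernstein_def)
next
  case (Suc m)
  let ?w = "\<lambda>j. lazy_walk 1 j f z"
  have B0: "Bernstein (Suc m) 0 \<theta> = (1 - \<theta>) * Bernstein m 0 \<theta>"
    by (simp add: Bernstein_def)
  \<comment> \<open>The Bernstein polynomials are the binomial weights of the number
    \<open>j\<close> of steps that really move. This is their recursion according to whether one
    further step moves or rests.\<close>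
  have BS: "Bernstein (Suc m) (Suc j) \<theta> = \<theta> * Bernstein m j \<theta> + (1 - \<theta>) * Bernstein m (Suc j) \<theta>"
    if "j \<le> m" for j
  proof (cases "j = m")
    case False
    then have "m - j = Suc (m - Suc j)" using that by simp
    then show ?thesis by (simp add: Bernstein_def algebra_simps)
  qed (simp add: Bernstein_def)
  have "(\<Sum>j\<le>Suc m. Bernstein (Suc m) j \<theta> * ?w j) =
      (1 - \<theta>) * Bernstein m 0 \<theta> * ?w 0 +
      (\<Sum>j\<le>m. (\<theta> * Bernstein m j \<theta> + (1 - \<theta>) * Bernstein m (Suc j) \<theta>) * ?w (Suc j))"
    by (simp add: sum.atMost_Suc_shift B0 BS del: lazy_walk.simps sum.atMost_Suc)
  also have "\<dots> = (1 - \<theta>) * (Bernstein m 0 \<theta> * ?w 0 + (\<Sum>j\<le>m. Bernstein m (Suc j) \<theta> * ?w (Suc j)))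
      + \<theta> * (\<Sum>j\<le>m. Bernstein m j \<theta> * ?w (Suc j))"
    by (simp add: sum.distrib sum_subtractf sum_distrib_left algebra_simps del: lazy_walk.simps)
  also have "Bernstein m 0 \<theta> * ?w 0 + (\<Sum>j\<le>m. Bernstein m (Suc j) \<theta> * ?w (Suc j))
      = (\<Sum>j\<le>Suc m. Bernstein m j \<theta> * ?w j)"
    by (simp add: sum.atMost_Suc_shift del: lazy_walk.simps sum.atMost_Suc)
  also have "\<dots> = (\<Sum>j\<le>m. Bernstein m j \<theta> * ?w j)"
    by (simp add: Bernstein_def)
  also have "(\<Sum>j\<le>m. Bernstein m j \<theta> * ?w (Suc j)) =
      (lazy_walk \<theta> m f (z + 1) + lazy_walk \<theta> m f (z - 1)) / 2"
    unfolding Suc by (simp add: sum.distrib[symmetric] sum_divide_distrib field_simps)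
  finally show ?case using Suc by simp
qed

lemma simple_walk_eq_binomial:
  "lazy_walk 1 j f z = (\<Sum>i\<le>j. real (j choose i) * f (z + 2 * int i - int j)) / 2 ^ j"
proof (induction j arbitrary: z)
  case (Suc j)
  let ?g = "\<lambda>i. f (z + 2 * int i - int (Suc j))"
  have "(\<Sum>i\<le>Suc j. real (Suc j choose i) * ?g i) =
      ?g 0 + (\<Sum>i\<le>j. (real (j choose i) + real (j choose Suc i)) * ?g (Suc i))"
    by (simp add: sum.atMost_Suc_shift del: of_nat_Suc sum.atMost_Suc)
  also have "\<dots> = (\<Sum>i\<le>j. real (j choose i) * ?g (Suc i)) + (?g 0 + (\<Sum>i\<le>j. real (j choose Suc i) * ?g (Suc i)))"
    by (simp add: sum.distrib algebra_simps)
  also have "?g 0 + (\<Sum>i\<le>j. real (j choose Suc i) * ?g (Suc i)) = (\<Sum>i\<le>Suc j. real (j choose i) * ?g i)"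
    by (simp add: sum.atMost_Suc_shift del: of_nat_Suc sum.atMost_Suc)
  also have "\<dots> = (\<Sum>i\<le>j. real (j choose i) * ?g i)" by simp
  finally have "(\<Sum>i\<le>Suc j. real (Suc j choose i) * ?g i) =
    (\<Sum>i\<le>j. real (j choose i) * f (z + 1 + 2 * int i - int j))
        + (\<Sum>i\<le>j. real (j choose i) * f (z - 1 + 2 * int i - int j))"
    by (simp add: algebra_simps)
  then show ?case by (simp add: Suc field_simps del: sum.atMost_Suc)
qed simp

definition central_prob :: "nat \<Rightarrow> real" where
  "central_prob l = real ((2 * l) choose l) / 4 ^ l"

lemma walk_at_zero_simple_even: "walk_at_zero 1 (2 * l) 0 = central_prob l"
proof -
  have "(\<Sum>i\<le>2 * l. real ((2 * l) choose i) * of_bool (0 + 2 * int i - int (2 * l) = 0))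
      = (\<Sum>i\<le>2 * l. if i = l then real ((2 * l) choose i) else 0)"
    by (intro sum.cong) auto
  also have "\<dots> = real ((2 * l) choose l)" by (subst sum.delta) auto
  finally show ?thesis
    unfolding walk_at_zero_def simple_walk_eq_binomial by (simp add: central_prob_def power_mult)
qed

lemma walk_at_zero_simple_odd: "walk_at_zero 1 (Suc (2 * l)) 0 = 0"
proof -
  have "(\<Sum>i\<le>Suc (2 * l). real (Suc (2 * l) choose i) * of_bool (0 + 2 * int i - int (Suc (2 * l)) = 0))
      = (\<Sum>i\<le>Suc (2 * l). 0)"
    by (intro sum.cong) (auto, presburger)
  then show ?thesis
    unfolding walk_at_zero_def simple_walk_eq_binomial by simp
qed

lemma central_prob_Suc: "central_prob (Suc l) = central_prob l * (2 * real l + 1) / (2 * real l + 2)"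
proof -
  have a: "Suc l * (Suc (2 * l) choose Suc l) = Suc (2 * l) * ((2 * l) choose l)"
    by (rule Suc_times_binomial)
  have b: "Suc l * (Suc (Suc (2 * l)) choose Suc l) = Suc (Suc (2 * l)) * (Suc (2 * l) choose l)"
    by (rule Suc_times_binomial)
  have c: "Suc (2 * l) choose l = Suc (2 * l) choose Suc l"
    by (subst binomial_symmetric) auto
  have a': "real (Suc l) * real (Suc (2 * l) choose Suc l) = real (Suc (2 * l)) * real ((2 * l) choose l)"
    using arg_cong[OF a, of real] by (simp only: of_nat_mult)
  have b': "real (Suc l) * real (Suc (Suc (2 * l)) choose Suc l)
      = real (Suc (Suc (2 * l))) * real (Suc (2 * l) choose Suc l)"
    using arg_cong[OF b, of real] by (simp only: of_nat_mult c)
  have "real (Suc l) * real (Suc (Suc (2 * l)) choose Suc l) * real (Suc l)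
      = real (Suc (Suc (2 * l))) * (real (Suc l) * real (Suc (2 * l) choose Suc l))"
    unfolding b' by (simp only: mult_ac)
  then have "real (Suc l) * real (Suc (Suc (2 * l)) choose Suc l) * real (Suc l)
      = real (Suc (Suc (2 * l))) * (real (Suc (2 * l)) * real ((2 * l) choose l))"
    unfolding a' .
  moreover have "real (Suc (Suc (2 * l))) = 2 * real (Suc l)" by simp
  ultimately have "real (Suc l) * (real (Suc (Suc (2 * l)) choose Suc l) * real (Suc l))
      = real (Suc l) * (2 * (real (Suc (2 * l)) * real ((2 * l) choose l)))"
    by (simp only: mult_ac)
  then have "real (Suc (Suc (2 * l)) choose Suc l) * real (Suc l)
      = 2 * (real (Suc (2 * l)) * real ((2 * l) choose l))"
    by (simp only: mult_cancel_left of_nat_eq_0_iff) simp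
  then have "real ((2 * Suc l) choose Suc l)
      = 2 * (real (Suc (2 * l)) * real ((2 * l) choose l)) / real (Suc l)"
    by (simp add: eq_divide_eq del: of_nat_Suc binomial_Suc_Suc)
  then show ?thesis unfolding central_prob_def by (simp add: divide_simps del: binomial_Suc_Suc mult_Suc_right)
      (simp add: algebra_simps del: binomial_Suc_Suc mult_Suc_right)
qed

text \<open>In the Tanaka recursion only returns at even times add to the mean, and \<open>(2 * l +
  1) * central_prob l = (2 * l + 2) * central_prob (Suc l)\<close> keeps the closed form
  intact.\<close>

lemma walk_abs_simple_even: "walk_abs 1 (2 * l) 0 = 2 * real l * central_prob l"
proof (induction l)
  case (Suc l)
  have "walk_abs 1 (2 * Suc l) 0 = walk_abs 1 (2 * l) 0 + central_prob l"
    using walk_abs_Suc[of 1 "Suc (2 * l)" 0] walk_abs_Suc[of 1 "2 * l" 0]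
    by (simp add: walk_at_zero_simple_even walk_at_zero_simple_odd)
  then show ?case using Suc by (simp add: central_prob_Suc field_simps)
qed (simp add: walk_abs_def)

text \<open>At an odd time the simple walk from 0 is not at 0, so the next step leaves the mean
  absolute value unchanged.\<close>

lemma walk_abs_simple_odd: "walk_abs 1 (Suc (2 * l)) 0 = walk_abs 1 (2 * Suc l) 0"
  using walk_abs_Suc[of 1 "Suc (2 * l)" 0] by (simp add: walk_at_zero_simple_odd)

lemma central_prob_asymp: "(\<lambda>l. 2 * real l * (central_prob l)\<^sup>2) \<longlonglongrightarrow> 2 / pi"
proof -
  let ?W = "\<lambda>n. \<Prod>k=1..n. (4*real k^2) / (4*real k^2 - 1)"
  \<comment> \<open>The squared return probability times \<open>2 * n + 1\<close> is exactly the
    reciprocal of the partial Wallis product, so the limit needs no Stirling estimate.\<close>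
  have W: "?W n * ((central_prob n)\<^sup>2 * (2 * real n + 1)) = 1" for n
  proof (induction n)
    case (Suc n)
    have nz: "4 * real (Suc n)^2 - 1 = (2 * real n + 1) * (2 * real n + 3)"
      by (simp add: power2_eq_square algebra_simps)
    have "?W (Suc n) * ((central_prob (Suc n))\<^sup>2 * (2 * real (Suc n) + 1)) =
      ?W n * ((4 * real (Suc n)^2) / (4*real (Suc n)^2 - 1) *
        ((central_prob n * (2 * real n + 1) / (2 * real n + 2))\<^sup>2 * (2 * real (Suc n) + 1)))"
      by (simp add: prod.nat_ivl_Suc' central_prob_Suc del: of_nat_Suc)
    also have "(4 * real (Suc n)^2) / (4*real (Suc n)^2 - 1) *
        ((central_prob n * (2 * real n + 1) / (2 * real n + 2))\<^sup>2 * (2 * real (Suc n) + 1))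
       = (central_prob n)\<^sup>2 * (2 * real n + 1)"
      unfolding nz by (simp add: divide_simps power2_eq_square) (simp add: algebra_simps)
    also note Suc.IH
    finally show ?case .
  qed (simp add: central_prob_def)
  have eq: "(central_prob n)\<^sup>2 * (2 * real n + 1) = inverse (?W n)" for n
    using inverse_unique[OF W[of n]] by simp
  have 1: "(\<lambda>n. (central_prob n)\<^sup>2 * (2 * real n + 1)) \<longlonglongrightarrow> inverse (pi / 2)"
    unfolding eq by (intro tendsto_inverse wallis) simp
  have 2: "(\<lambda>n. 2 * real n / (2 * real n + 1)) \<longlonglongrightarrow> 1" by real_asymp
  from tendsto_mult[OF 1 2] have "(\<lambda>n. (central_prob n)\<^sup>2 * (2 * real n + 1)
      * (2 * real n / (2 * real n + 1))) \<longlonglongrightarrow> 2 / pi"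
    by simp
  moreover have "(central_prob n)\<^sup>2 * (2 * real n + 1) * (2 * real n / (2 * real n + 1))
      = 2 * real n * (central_prob n)\<^sup>2" for n
    by (simp add: field_simps)
  ultimately show ?thesis by (simp add: mult_ac)
qed

lemma walk_abs_simple_asymp:
  "(\<lambda>j. walk_abs 1 j 0 / sqrt (real j)) \<longlonglongrightarrow> sqrt (2 / pi)"
proof -
  have pos: "central_prob l \<ge> 0" for l by (simp add: central_prob_def)
  have ev: "walk_abs 1 (2 * l) 0 / sqrt (real (2 * l)) = sqrt (2 * real l * (central_prob l)\<^sup>2)" for l
  proof -
    have "sqrt (2 * real l * (central_prob l)\<^sup>2) = sqrt (real (2 * l)) * central_prob l"
      using pos[of l] by (simp add: real_sqrt_mult)
    also have "\<dots> = 2 * real l * central_prob l / sqrt (real (2 * l))"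
      by (cases "l = 0") (auto simp: divide_simps real_sqrt_mult[symmetric] simp flip: power2_eq_square)
    finally show ?thesis by (simp add: walk_abs_simple_even)
  qed
  have 1: "(\<lambda>l. walk_abs 1 (2 * l) 0 / sqrt (real (2 * l))) \<longlonglongrightarrow> sqrt (2 / pi)"
    unfolding ev by (intro tendsto_real_sqrt central_prob_asymp)
  have 2: "(\<lambda>l. walk_abs 1 (2 * Suc l) 0 / sqrt (real (2 * Suc l))
      * (sqrt (real (2 * Suc l)) / sqrt (real (Suc (2 * l)))))
      \<longlonglongrightarrow> sqrt (2 / pi) * 1"
  proof (rule tendsto_mult)
    show "(\<lambda>l. walk_abs 1 (2 * Suc l) 0 / sqrt (real (2 * Suc l))) \<longlonglongrightarrow> sqrt (2 / pi)"
      using LIMSEQ_Suc[OF 1] .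
    show "(\<lambda>l. sqrt (real (2 * Suc l)) / sqrt (real (Suc (2 * l)))) \<longlonglongrightarrow> 1"
      by (simp add: algebra_simps) real_asymp
  qed
  have "walk_abs 1 (2 * Suc l) 0 / sqrt (real (2 * Suc l))
      * (sqrt (real (2 * Suc l)) / sqrt (real (Suc (2 * l))))
      = walk_abs 1 (Suc (2 * l)) 0 / sqrt (real (Suc (2 * l)))" for l
    by (simp add: walk_abs_simple_odd)
  with 2 have 3: "(\<lambda>l. walk_abs 1 (Suc (2 * l)) 0 / sqrt (real (Suc (2 * l)))) \<longlonglongrightarrow> sqrt (2 / pi)"
    by simp
  show ?thesis
  proof (rule LIMSEQ_I)
    fix e :: real assume "0 < e"
    then obtain N1 N2 where
      N1: "\<And>l. l \<ge> N1 \<Longrightarrow> norm (walk_abs 1 (2 * l) 0 / sqrt (real (2 * l)) - sqrt (2 / pi)) < e" and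
      N2: "\<And>l. l \<ge> N2 \<Longrightarrow> norm (walk_abs 1 (Suc (2 * l)) 0 / sqrt (real (Suc (2 * l))) - sqrt (2 / pi)) < e"
      using LIMSEQ_D[OF 1] LIMSEQ_D[OF 3] by meson
    have "norm (walk_abs 1 j 0 / sqrt (real j) - sqrt (2 / pi)) < e" if "j \<ge> 2 * N1 + 2 * N2 + 2" for j
    proof (cases "even j")
      case True
      then obtain l where "j = 2 * l" by blast
      then show ?thesis using N1[of l] that by simp
    next
      case False
      then obtain l where "j = Suc (2 * l)" by (metis oddE Suc_eq_plus1)
      then show ?thesis using N2[of l] that by simp
    qed
    then show "\<exists>N. \<forall>j\<ge>N. norm (walk_abs 1 j 0 / sqrt (real j) - sqrt (2 / pi)) < e" by blast
  qed
qed

text \<open>The additive \<open>K\<close> absorbs the finitely many small \<open>j\<close>. The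
  bound then holds for every \<open>j\<close>, including 0, and can be averaged against binomial
  weights.\<close>

lemma walk_abs_simple_approx:
  assumes "0 < \<epsilon>"
  obtains K where "0 \<le> K" "\<And>j. \<bar>walk_abs 1 j 0 - sqrt (2 / pi) * sqrt (real j)\<bar> \<le> \<epsilon> * sqrt (real j) + K"
proof -
  let ?d = "\<lambda>j. \<bar>walk_abs 1 j 0 - sqrt (2 / pi) * sqrt (real j)\<bar>"
  obtain N where N: "\<And>j. j \<ge> N \<Longrightarrow> norm (walk_abs 1 j 0 / sqrt (real j) - sqrt (2 / pi)) < \<epsilon>"
    using LIMSEQ_D[OF walk_abs_simple_asymp assms] by blast
  have "?d j \<le> \<epsilon> * sqrt (real j) + (\<Sum>i\<le>N. ?d i)" for j
  proof (cases "j \<le> N")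
    case True
    then have "?d j \<le> (\<Sum>i\<le>N. ?d i)" by (intro member_le_sum) auto
    then show ?thesis using assms by (simp add: add_increasing)
  next
    case False
    then have j: "sqrt (real j) > 0" by simp
    then have "walk_abs 1 j 0 - sqrt (2 / pi) * sqrt (real j)
        = (walk_abs 1 j 0 / sqrt (real j) - sqrt (2 / pi)) * sqrt (real j)"
      by (simp add: left_diff_distrib)
    then have "?d j = \<bar>walk_abs 1 j 0 / sqrt (real j) - sqrt (2 / pi)\<bar> * sqrt (real j)"
      using j by (simp add: abs_mult)
    also have "\<dots> \<le> \<epsilon> * sqrt (real j)"
      using N[of j] False j by (intro mult_right_mono) auto
    finally show ?thesis by (rule order_trans) (simp add: sum_nonneg)
  qed
  then show ?thesis by (intro that[of "\<Sum>i\<le>N. ?d i"] sum_nonneg) auto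
qed

text \<open>With \<open>\<mu>\<close> the binomial mean, the difference of square roots is at most
  \<open>\<bar>j - \<mu>\<bar> / sqrt \<mu>\<close>, and \<open>x \<le> 1 / 2 + x^2 / 2\<close>
  turns this into a second moment. The binomial variance \<open>\<mu> * (1 - \<theta>)\<close> gives
  the total \<open>1 - \<theta> / 2\<close>.\<close>

lemma Bernstein_abs_sqrt_diff:
  assumes "0 < \<theta>" "\<theta> \<le> 1"
  shows "(\<Sum>j\<le>m. Bernstein m j \<theta> * \<bar>sqrt (real j) - sqrt (\<theta> * real m)\<bar>) \<le> 1"
proof (cases "m = 0")
  case False
  define \<mu> where "\<mu> = \<theta> * real m"
  have \<mu>: "0 < \<mu>" using assms False by (simp add: \<mu>_def)
  have pt: "\<bar>sqrt (real j) - sqrt \<mu>\<bar> \<le> 1 / 2 + (real j - \<mu>)\<^sup>2 / (2 * \<mu>)" for j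
  proof -
    define a where "a = sqrt (real j)"
    define b where "b = sqrt \<mu>"
    have ab: "a \<ge> 0" "b > 0" using \<mu> by (auto simp: a_def b_def)
    have sq: "real j = a\<^sup>2" "\<mu> = b\<^sup>2" using \<mu> by (auto simp: a_def b_def)
    have "\<bar>a - b\<bar> * b \<le> \<bar>a - b\<bar> * (a + b)" using ab by (intro mult_left_mono) auto
    also have "\<dots> = \<bar>a\<^sup>2 - b\<^sup>2\<bar>"
      using ab by (subst abs_mult_pos) (auto simp: power2_eq_square algebra_simps)
    finally have 1: "\<bar>a - b\<bar> \<le> \<bar>a\<^sup>2 - b\<^sup>2\<bar> / b" using ab by (simp add: field_simps)
    have "0 \<le> (\<bar>a\<^sup>2 - b\<^sup>2\<bar> / b - 1)\<^sup>2" by simp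
    then have "\<bar>a\<^sup>2 - b\<^sup>2\<bar> / b \<le> 1 / 2 + (\<bar>a\<^sup>2 - b\<^sup>2\<bar> / b)\<^sup>2 / 2"
      by (simp add: power2_diff)
    with 1 have "\<bar>a - b\<bar> \<le> 1 / 2 + (a\<^sup>2 - b\<^sup>2)\<^sup>2 / (2 * b\<^sup>2)" by (simp add: power_divide)
    then show ?thesis unfolding a_def[symmetric] b_def[symmetric] unfolding sq .
  qed
  have "(\<Sum>j\<le>m. Bernstein m j \<theta> * \<bar>sqrt (real j) - sqrt \<mu>\<bar>)
      \<le> (\<Sum>j\<le>m. Bernstein m j \<theta> * (1 / 2 + (real j - \<mu>)\<^sup>2 / (2 * \<mu>)))"
    using assms by (intro sum_mono mult_left_mono pt Bernstein_nonneg) auto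
  also have "\<dots> = (\<Sum>j\<le>m. (1 / 2 + \<mu> / 2) * Bernstein m j \<theta>
      + 1 / (2 * \<mu>) * (real j * (real j - 1) * Bernstein m j \<theta>)
      + (1 / (2 * \<mu>) - 1) * (real j * Bernstein m j \<theta>))"
    using \<mu> by (intro sum.cong refl) (simp add: field_simps power2_eq_square)
  also have "\<dots> = (1 / 2 + \<mu> / 2) * 1 + 1 / (2 * \<mu>) * (real m * (real m - 1) * \<theta>\<^sup>2) + (1 / (2 * \<mu>) - 1) * \<mu>"
    by (simp only: sum.distrib sum_distrib_left[symmetric] sum_Bernstein sum_k_Bernstein sum_kk_Bernstein)
      (simp add: \<mu>_def)
  also have "real m * (real m - 1) * \<theta>\<^sup>2 = \<mu>\<^sup>2 - \<theta> * \<mu>"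
    by (simp add: \<mu>_def power2_eq_square algebra_simps)
  also have "(1 / 2 + \<mu> / 2) * 1 + 1 / (2 * \<mu>) * (\<mu>\<^sup>2 - \<theta> * \<mu>) + (1 / (2 * \<mu>) - 1) * \<mu> = 1 - \<theta> / 2"
    using \<mu> by (simp add: field_simps power2_eq_square)
  finally show ?thesis using assms by (simp add: \<mu>_def)
qed (simp add: Bernstein_def)

text \<open>\<open>K\<close> must be uniform in \<open>\<theta>\<close> because the laziness of the
  difference walk varies with \<open>n\<close>. The simple walk estimate is averaged over the number
  of moves, whose square root stays within mean distance 1 of
  \<open>sqrt (\<theta> * m)\<close>.\<close>

lemma walk_abs_approx:
  assumes "0 < \<epsilon>"
  obtains K where "0 \<le> K" "\<And>\<theta> m. 0 < \<theta> \<Longrightarrow> \<theta> \<le> 1 \<Longrightarrow>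
    \<bar>walk_abs \<theta> m 0 - sqrt (2 / pi) * sqrt (\<theta> * real m)\<bar> \<le> \<epsilon> * sqrt (\<theta> * real m) + K"
proof -
  obtain K where K: "0 \<le> K" "\<And>j. \<bar>walk_abs 1 j 0 - sqrt (2 / pi) * sqrt (real j)\<bar> \<le> \<epsilon> * sqrt (real j) + K"
    using walk_abs_simple_approx[OF assms] by blast
  let ?c = "sqrt (2 / pi)"
  have "\<bar>walk_abs \<theta> m 0 - ?c * sqrt (\<theta> * real m)\<bar> \<le> \<epsilon> * sqrt (\<theta> * real m) + (K + ?c + \<epsilon>)"
    if \<theta>: "0 < \<theta>" "\<theta> \<le> 1" for \<theta> m
  proof -
    let ?B = "\<lambda>j. Bernstein m j \<theta>"
    let ?s = "sqrt (\<theta> * real m)"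
    have B: "0 \<le> ?B j" for j using \<theta> by (intro Bernstein_nonneg) auto
    have pt: "\<bar>walk_abs 1 j 0 - ?c * ?s\<bar> \<le> (\<epsilon> * ?s + K) + (\<epsilon> + ?c) * \<bar>sqrt (real j) - ?s\<bar>" for j
    proof -
      have 1: "\<bar>walk_abs 1 j 0 - ?c * ?s\<bar>
          \<le> \<bar>walk_abs 1 j 0 - ?c * sqrt (real j)\<bar> + \<bar>?c * sqrt (real j) - ?c * ?s\<bar>"
        by linarith
      have 2: "\<bar>?c * sqrt (real j) - ?c * ?s\<bar> = ?c * \<bar>sqrt (real j) - ?s\<bar>"
        by (simp add: abs_mult flip: right_diff_distrib)
      have 3: "\<epsilon> * sqrt (real j) \<le> \<epsilon> * (?s + \<bar>sqrt (real j) - ?s\<bar>)"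
        using assms by (intro mult_left_mono) auto
      show ?thesis using 1 2 3 K(2)[of j] by (simp add: algebra_simps)
    qed
    have "walk_abs \<theta> m 0 = (\<Sum>j\<le>m. ?B j * walk_abs 1 j 0)"
      unfolding walk_abs_def by (rule lazy_walk_eq_Bernstein)
    moreover have "?c * ?s = (\<Sum>j\<le>m. ?B j * (?c * ?s))"
      by (simp flip: sum_distrib_right)
    ultimately have "walk_abs \<theta> m 0 - ?c * ?s = (\<Sum>j\<le>m. ?B j * (walk_abs 1 j 0 - ?c * ?s))"
      by (simp only: right_diff_distrib sum_subtractf)
    then have "\<bar>walk_abs \<theta> m 0 - ?c * ?s\<bar> \<le> (\<Sum>j\<le>m. ?B j * \<bar>walk_abs 1 j 0 - ?c * ?s\<bar>)"
      using sum_abs[of "\<lambda>j. ?B j * (walk_abs 1 j 0 - ?c * ?s)" "{..m}"] B by (simp add: abs_mult)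
    also have "\<dots> \<le> (\<Sum>j\<le>m. ?B j * ((\<epsilon> * ?s + K) + (\<epsilon> + ?c) * \<bar>sqrt (real j) - ?s\<bar>))"
      by (intro sum_mono mult_left_mono pt B)
    also have "\<dots> = (\<epsilon> * ?s + K) * (\<Sum>j\<le>m. ?B j) + (\<epsilon> + ?c) * (\<Sum>j\<le>m. ?B j * \<bar>sqrt (real j) - ?s\<bar>)"
      unfolding sum_distrib_left sum.distrib[symmetric] by (intro sum.cong refl) (simp add: algebra_simps)
    also have "\<dots> \<le> (\<epsilon> * ?s + K) * 1 + (\<epsilon> + ?c) * 1"
      using Bernstein_abs_sqrt_diff[OF \<theta>, of m] assms
          by (intro add_mono mult_left_mono) (use K(1) \<theta> in \<open>auto intro!: add_nonneg_nonneg mult_nonneg_nonneg\<close>)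
    finally show ?thesis by (simp add: algebra_simps)
  qed
  then show ?thesis using K(1) assms by (intro that[of "K + ?c + \<epsilon>"]) auto
qed

section \<open>The order of a pair of markers\<close>

abbreviation swp :: "nat \<Rightarrow> nat \<Rightarrow> nat" where
  "swp e \<equiv> Transposition.transpose e (Suc e)"

lemma swp_in_range: "e \<in> {1..<n} \<Longrightarrow> swp e x \<in> {1..n} \<longleftrightarrow> x \<in> {1..n}"
  by (auto simp: Transposition.transpose_def)

lemma sum_swp: "e \<in> {1..<n} \<Longrightarrow> (\<Sum>x\<in>{1..n}. f (swp e x)) = (\<Sum>x\<in>{1..n}. f x)"
  by (rule sum.reindex_bij_betw) (simp add: bij_betw_transpose_iff)

text \<open>Expected sign of the displacement from the first to the second of two markers now at
  \<open>x\<close> and \<open>y\<close>, after \<open>k\<close> uniform swaps. The recursion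
  averages over the first swap; it closes because the locations of a pair evolve independently of
  the other markers.\<close>

fun pair_order :: "nat \<Rightarrow> nat \<Rightarrow> nat \<Rightarrow> nat \<Rightarrow> real" where
  "pair_order n 0 x y = of_int (sgn (int y - int x))"
| "pair_order n (Suc k) x y = (\<Sum>e\<in>{1..<n}. pair_order n k (swp e x) (swp e y)) / real (n - 1)"

lemma pair_order_swap: "pair_order n k y x = - pair_order n k x y"
proof (induction k arbitrary: x y)
  case (Suc k)
  have "(\<Sum>e\<in>{1..<n}. pair_order n k (swp e y) (swp e x)) = (\<Sum>e\<in>{1..<n}. - pair_order n k (swp e x) (swp e y))"
    by (intro sum.cong refl Suc.IH)
  then show ?case by (simp only: pair_order.simps sum_negf minus_divide_left)
qed (simp add: sgn_if)

lemma pair_order_same [simp]: "pair_order n k x x = 0"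
  using pair_order_swap[of n k x x] by simp

text \<open>Every swap except the one at \<open>x\<close> keeps \<open>x\<close> and
  \<open>Suc x\<close> in weak order, so its contribution is nonnegative by induction. The swap at
  \<open>x\<close> reverses the gap \<open>\<delta>\<close>, and is compensated by a swap
  \<open>f\<close> far from all locations involved, which reproduces \<open>\<delta>\<close>
  unchanged.\<close>

lemma pair_order_antimono_Suc:
  assumes n: "7 \<le> n"
  shows "x \<in> {1..<n} \<Longrightarrow> y \<in> {1..n} \<Longrightarrow> pair_order n k (Suc x) y \<le> pair_order n k x y"
proof (induction k arbitrary: x y)
  case 0
  then show ?case by (auto simp: sgn_if)
next
  case (Suc k)
  let ?h = "pair_order n k"
  have mono: "?h b y \<le> ?h a y" if "a \<le> b" "1 \<le> a" "b \<le> n" "y \<in> {1..n}" for a b y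
    using that(1,3)
  proof (induction b rule: dec_induct)
    case (step b)
    then show ?case using Suc.IH[of b y] that by fastforce
  qed simp
  define D where "D e = ?h (swp e x) (swp e y) - ?h (swp e (Suc x)) (swp e y)" for e
  define \<delta> where "\<delta> = ?h x y - ?h (Suc x) y"
  \<comment> \<open>At most five swaps touch \<open>x\<close>, \<open>Suc x\<close> or
    \<open>y\<close>, and \<open>n \<ge> 7\<close> offers at least six.\<close>
  have "card (set [x - 1, x, Suc x, y - 1, y]) \<le> 5"
    by (rule order_trans[OF card_length]) simp
  moreover have "card {1..<n} - card (set [x - 1, x, Suc x, y - 1, y])
      \<le> card ({1..<n} - set [x - 1, x, Suc x, y - 1, y])"
    by (rule diff_card_le_card_Diff) (rule finite_set)
  ultimately have "card ({1..<n} - set [x - 1, x, Suc x, y - 1, y]) > 0" using n by (simp del: list.set)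
  then have "{1..<n} - set [x - 1, x, Suc x, y - 1, y] \<noteq> {}" by (metis card.empty less_irrefl)
  then obtain f where "f \<in> {1..<n} - set [x - 1, x, Suc x, y - 1, y]" by blast
  then have f: "f \<in> {1..<n}" "f \<notin> {x - 1, x, Suc x, y - 1, y}" by simp_all
  have Df: "D f = \<delta>"
    using f Suc.prems by (auto simp: D_def \<delta>_def Transposition.transpose_def)
  \<comment> \<open>If \<open>y\<close> is itself \<open>x\<close> or \<open>Suc x\<close>, the swap
    moves it too; antisymmetry of \<open>pair_order\<close> still gives
    \<open>- \<delta>\<close>.\<close>
  have Dx: "D x = - \<delta>"
    using pair_order_swap[of n k x "Suc x"] by (auto simp: D_def \<delta>_def Transposition.transpose_def)
  have De: "D e \<ge> 0" if "e \<in> {1..<n}" "e \<noteq> x" for e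
  proof -
    have "swp e x \<le> swp e (Suc x)" using that by (auto simp: Transposition.transpose_def)
    moreover have "swp e x \<in> {1..n}" "swp e (Suc x) \<in> {1..n}" "swp e y \<in> {1..n}"
      using swp_in_range[OF that(1)] Suc.prems by auto
    ultimately show ?thesis using mono by (auto simp: D_def)
  qed
  have "(\<Sum>e\<in>{1..<n}. D e) = D x + (D f + (\<Sum>e\<in>{1..<n} - {x} - {f}. D e))"
    using f Suc.prems by (subst sum.remove[of _ x]) (auto intro!: sum.remove)
  also have "\<dots> \<ge> 0"
  proof -
    have "0 \<le> (\<Sum>e\<in>{1..<n} - {x} - {f}. D e)"
      by (intro sum_nonneg De) auto
    then show ?thesis by (simp add: Df Dx)
  qed
  finally have "0 \<le> (\<Sum>e\<in>{1..<n}. D e)" .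
  then show ?case by (simp add: D_def sum_subtractf divide_right_mono)
qed

section \<open>One-particle row sums and the influence of a single swap\<close>

definition row_sum :: "nat \<Rightarrow> nat \<Rightarrow> nat \<Rightarrow> real" where
  "row_sum n k x = (\<Sum>y\<in>{1..n}. pair_order n k x y)"

lemma row_sum_0:
  assumes "x \<in> {1..n}"
  shows "row_sum n 0 x = real n + 1 - 2 * real x"
proof -
  have "row_sum n 0 x = (\<Sum>y\<in>{1..n}. of_int (sgn (int y - int x)))" by (simp add: row_sum_def)
  also have "{1..n} = {1..<x} \<union> {x} \<union> {x<..n}" using assms by auto
  also have "(\<Sum>y\<in>\<dots>. of_int (sgn (int y - int x))) = (\<Sum>y\<in>{1..<x}. - 1) + (\<Sum>y\<in>{x<..n}. (1::real))"
    by (subst sum.union_disjoint | force simp: sgn_if intro!: arg_cong2[where f="(+)"] sum.cong)+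
  finally show ?thesis using assms by (simp add: of_nat_diff)
qed

text \<open>A swap permutes the possible places of the second marker, so that marker is summed out
  and only the walk of the first one remains.\<close>

lemma row_sum_Suc: "row_sum n (Suc k) x = (\<Sum>e\<in>{1..<n}. row_sum n k (swp e x)) / real (n - 1)"
proof -
  have "row_sum n (Suc k) x = (\<Sum>e\<in>{1..<n}. \<Sum>y\<in>{1..n}. pair_order n k (swp e x) (swp e y)) / real (n - 1)"
    unfolding row_sum_def by (subst sum.swap) (simp add: sum_divide_distrib)
  also have "(\<Sum>e\<in>{1..<n}. \<Sum>y\<in>{1..n}. pair_order n k (swp e x) (swp e y)) = (\<Sum>e\<in>{1..<n}. row_sum n k (swp e x))"
    unfolding row_sum_def by (intro sum.cong refl sum_swp)
  finally show ?thesis .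
qed

lemma sum_at_swp:
  fixes f :: "nat \<Rightarrow> real"
  assumes "x \<in> {1..n}"
  shows "(\<Sum>e\<in>{1..<n}. f (swp e x)) =
    real (n - 1) * f x + (if 1 < x then f (x - 1) - f x else 0) + (if x < n then f (Suc x) - f x else 0)"
proof -
  have "(\<Sum>e\<in>{1..<n}. f (swp e x)) =
    (\<Sum>e\<in>{1..<n}. f x + (if e = x - 1 then f (x - 1) - f x else 0) + (if e = x then f (Suc x) - f x else 0))"
    using assms by (intro sum.cong) (auto simp: Transposition.transpose_def)
  also have "\<dots> = real (n - 1) * f x + (if x - 1 \<in> {1..<n} then f (x - 1) - f x else 0)
      + (if x \<in> {1..<n} then f (Suc x) - f x else 0)"
    by (simp only: sum.distrib sum.delta finite_atLeastLessThan sum_constant card_atLeastLessThan)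
  finally show ?thesis using assms by auto
qed

text \<open>The initial profile is linear with slope \<open>-2\<close>. The new decrement at
  \<open>x\<close> is an average of the old decrements at \<open>x - 1\<close>, \<open>x\<close> and
  \<open>Suc x\<close>, with weight \<open>(n - 3) / (n - 1)\<close> in the middle; a decrement
  missing at an end counts as 0, which also respects the bound 2.\<close>

lemma row_sum_diff:
  assumes n: "3 \<le> n"
  shows "x \<in> {1..<n} \<Longrightarrow> row_sum n k x - row_sum n k (Suc x) \<le> 2"
proof (induction k arbitrary: x)
  case 0
  then show ?case by (simp add: row_sum_0)
next
  case (Suc k)
  let ?R = "row_sum n k"
  have x: "x \<in> {1..n}" "Suc x \<in> {1..n}" using Suc.prems by auto
  have left: "?R (x - 1) - ?R x \<le> 2" if "1 < x"
  proof -
    have "x - 1 \<in> {1..<n}" using that Suc.prems by auto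
    then show ?thesis using Suc.IH[of "x - 1"] that by simp
  qed
  have "row_sum n (Suc k) x - row_sum n (Suc k) (Suc x)
     = ((real n - 3) * (?R x - ?R (Suc x)) + (if 1 < x then ?R (x - 1) - ?R x else 0)
       + (if Suc x < n then ?R (Suc x) - ?R (Suc (Suc x)) else 0)) / real (n - 1)"
    using Suc.prems n unfolding row_sum_Suc sum_at_swp[OF x(1)] sum_at_swp[OF x(2)]
    by (auto simp: of_nat_diff diff_divide_distrib[symmetric] algebra_simps)
  also have "\<dots> \<le> ((real n - 3) * 2 + 2 + 2) / real (n - 1)"
    using left Suc.IH[of x] Suc.IH[of "Suc x"] Suc.prems n
    by (intro divide_right_mono add_mono mult_left_mono) auto
  also have "\<dots> = 2" using n by (simp add: of_nat_diff field_simps)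
  finally show ?case .
qed

lemma pair_order_row_change:
  assumes n: "7 \<le> n" and x: "x \<in> {1..<n}"
  shows "(\<Sum>y\<in>{1..n}. \<bar>pair_order n k (Suc x) y - pair_order n k x y\<bar>) \<le> 2"
proof -
  have "(\<Sum>y\<in>{1..n}. \<bar>pair_order n k (Suc x) y - pair_order n k x y\<bar>)
      = (\<Sum>y\<in>{1..n}. pair_order n k x y - pair_order n k (Suc x) y)"
  proof (intro sum.cong refl)
    fix y assume "y \<in> {1..n}"
    from pair_order_antimono_Suc[OF n x this, of k]
    show "\<bar>pair_order n k (Suc x) y - pair_order n k x y\<bar> = pair_order n k x y - pair_order n k (Suc x) y"
      by simp
  qed
  also have "\<dots> = row_sum n k x - row_sum n k (Suc x)"
    by (simp add: row_sum_def sum_subtractf)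
  also have "\<dots> \<le> 2" using n x by (intro row_sum_diff) auto
  finally show ?thesis .
qed

text \<open>The two coordinates are swapped one after the other. Each time only the lines through
  \<open>e\<close> and \<open>Suc e\<close> change, each by at most 2, which gives 4 per
  coordinate.\<close>

lemma pair_order_swap_change:
  assumes n: "7 \<le> n" and e: "e \<in> {1..<n}"
  shows "(\<Sum>x\<in>{1..n}. \<Sum>y\<in>{1..n}. \<bar>pair_order n k (swp e x) (swp e y) - pair_order n k x y\<bar>) \<le> 8"
proof -
  let ?h = "pair_order n k"
  let ?F = "\<lambda>x. \<Sum>y\<in>{1..n}. \<bar>?h (swp e x) y - ?h x y\<bar>"
  have "(\<Sum>x\<in>{1..n}. ?F x) = (\<Sum>x\<in>{e, Suc e}. ?F x)"
    using e by (intro sum.mono_neutral_right) (auto simp: Transposition.transpose_def)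
  also have "\<dots> \<le> 4"
    using pair_order_row_change[OF n e, of k] by (simp add: abs_minus_commute)
  finally have F: "(\<Sum>x\<in>{1..n}. ?F x) \<le> 4" .
  have "\<bar>?h (swp e x) (swp e y) - ?h x y\<bar>
      \<le> \<bar>?h (swp e x) (swp e y) - ?h x (swp e y)\<bar> + \<bar>?h (swp e y) x - ?h y x\<bar>" for x y
    using pair_order_swap[of n k x "swp e y"] pair_order_swap[of n k x y] by linarith
  then have "(\<Sum>x\<in>{1..n}. \<Sum>y\<in>{1..n}. \<bar>?h (swp e x) (swp e y) - ?h x y\<bar>)
      \<le> (\<Sum>x\<in>{1..n}. \<Sum>y\<in>{1..n}. \<bar>?h (swp e x) (swp e y) - ?h x (swp e y)\<bar> + \<bar>?h (swp e y) x - ?h y x\<bar>)"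
    by (intro sum_mono)
  also have "\<dots> = (\<Sum>x\<in>{1..n}. \<Sum>y\<in>{1..n}. \<bar>?h (swp e x) (swp e y) - ?h x (swp e y)\<bar>)
      + (\<Sum>x\<in>{1..n}. \<Sum>y\<in>{1..n}. \<bar>?h (swp e y) x - ?h y x\<bar>)"
    by (simp only: sum.distrib)
  also have "(\<Sum>x\<in>{1..n}. \<Sum>y\<in>{1..n}. \<bar>?h (swp e x) (swp e y) - ?h x (swp e y)\<bar>) = (\<Sum>x\<in>{1..n}. ?F x)"
    by (intro sum.cong refl sum_swp[OF e, where f = "\<lambda>y. \<bar>?h (swp e x) y - ?h x y\<bar>" for x])
  also have "(\<Sum>x\<in>{1..n}. \<Sum>y\<in>{1..n}. \<bar>?h (swp e y) x - ?h y x\<bar>) = (\<Sum>x\<in>{1..n}. ?F x)"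
    by (rule sum.swap)
  finally show ?thesis using F by simp
qed

text \<open>Marker pairs in the bulk see the difference walk; reflecting at the two ends costs the last two summands.\<close>

lemma sum_swp_difference:
  fixes q :: "int \<Rightarrow> real"
  assumes odd: "\<And>z. q (- z) = - q z" and xy: "x \<in> {1..n}" "y \<in> {1..n}"
  defines "F \<equiv> \<lambda>e. q (int (swp e y) - int (swp e x)) - q (int y - int x)"
  shows "(\<Sum>e\<in>{1..<n}. F e) =
    2 * (q (int y - int x + 1) + q (int y - int x - 1) - 2 * q (int y - int x)) - F 0 - F n"
proof -
  \<comment> \<open>The fictitious swaps 0 and \<open>n\<close>, which exchange an end location with
    one outside the segment, are included. Every marker then has both its swaps, and the difference
    moves exactly as on the whole line.\<close>
  have main: "(\<Sum>e\<in>{0..n}. q (int (swp e y) - int (swp e x)) - q (int y - int x)) =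
      2 * (q (int y - int x + 1) + q (int y - int x - 1) - 2 * q (int y - int x))"
    if "x < y" "x \<in> {1..n}" "y \<in> {1..n}" for x y
  proof -
    let ?z = "int y - int x"
    have [simp]: "q 0 = 0" using odd[of 0] by simp
    have q1: "q (-1) = - q 1" using odd[of 1] by simp
    have "(\<Sum>e\<in>{0..n}. q (int (swp e y) - int (swp e x)) - q ?z) =
      (\<Sum>e\<in>{0..n}. (if e = x - 1 then q (?z + 1) - q ?z else 0) + (if e = x then q (?z - 1) - q ?z else 0)
        + (if e = y - 1 then q (?z - 1) - q ?z else 0) + (if e = y then q (?z + 1) - q ?z else 0))"
    proof (intro sum.cong refl)
      fix e
      \<comment> \<open>If \<open>y = Suc x\<close>, the swap at \<open>x\<close> meets two of the
        four indicators at once, and \<open>q (-1) - q 1 = 2 * (q 0 - q 1)\<close> by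
        oddness.\<close>
      consider "e = x - 1" | "e = x" "y = Suc x" | "e = x" "y \<noteq> Suc x" | "e = y - 1" "y \<noteq> Suc x" | "e = y"
        | "e \<noteq> x" "e \<noteq> x - 1" "e \<noteq> y" "e \<noteq> y - 1" by (metis diff_Suc_1)
      then show "q (int (swp e y) - int (swp e x)) - q ?z =
        (if e = x - 1 then q (?z + 1) - q ?z else 0) + (if e = x then q (?z - 1) - q ?z else 0)
        + (if e = y - 1 then q (?z - 1) - q ?z else 0) + (if e = y then q (?z + 1) - q ?z else 0)"
        using that q1 by cases (auto simp: Transposition.transpose_def of_nat_diff algebra_simps)
    qed
    also have "\<dots> = 2 * (q (?z + 1) + q (?z - 1) - 2 * q ?z)"
      using that by (auto simp: sum.distrib sum.delta algebra_simps)
    finally show ?thesis .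
  qed
  have all: "(\<Sum>e\<in>{0..n}. F e) = 2 * (q (int y - int x + 1) + q (int y - int x - 1) - 2 * q (int y - int x))"
  proof (cases x y rule: linorder_cases)
    case less
    then show ?thesis using main[of x y] xy by (simp add: F_def)
  next
    case equal
    then show ?thesis using odd[of 1] odd[of 0] by (simp add: F_def)
  next
    case greater
    have neg: "q (int a - int b) = - q (int b - int a)" for a b
      using odd[of "int b - int a"] by simp
    have "(\<Sum>e\<in>{0..n}. F e) = (\<Sum>e\<in>{0..n}. - (q (int (swp e x) - int (swp e y)) - q (int x - int y)))"
      unfolding F_def using neg by (intro sum.cong refl) (metis minus_diff_minus)
    also have "\<dots> = - (\<Sum>e\<in>{0..n}. q (int (swp e x) - int (swp e y)) - q (int x - int y))"
      by (rule sum_negf)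
    also have "\<dots> = - (2 * (q (int x - int y + 1) + q (int x - int y - 1) - 2 * q (int x - int y)))"
      by (subst main[of y x]) (use greater xy in auto)
    finally show ?thesis
      using odd[of "int y - int x"] odd[of "int y - int x - 1"] odd[of "int y - int x + 1"]
          by (simp add: algebra_simps)
  qed
  have "{0..n} = insert 0 (insert n {1..<n})" using xy by auto
  then have "(\<Sum>e\<in>{0..n}. F e) = F 0 + (F n + (\<Sum>e\<in>{1..<n}. F e))"
    using xy by simp
  then show ?thesis using all by simp
qed

text \<open>Of the \<open>n - 1\<close> swaps, four move the difference of a bulk pair, two up and
  two down, hence the value of \<open>\<theta>\<close>; \<open>n \<ge> 5\<close> makes it a
  probability. Swaps only permute the pairs, so the accumulated error is not amplified, and each
  step adds at most \<open>(4 + 4) / (n - 1) = 2 * \<theta>\<close> from the two ends.\<close>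

lemma pair_order_approx:
  assumes n: "5 \<le> n"
  defines "\<theta> \<equiv> 4 / real (n - 1)"
  shows "(\<Sum>x\<in>{1..n}. \<Sum>y\<in>{1..n}. \<bar>pair_order n k x y - walk_sgn \<theta> k (int y - int x)\<bar>) \<le> 2 * \<theta> * real k"
proof (induction k)
  case 0
  show ?case by (simp add: walk_sgn_def)
next
  case (Suc k)
  let ?N = "real (n - 1)"
  let ?h = "pair_order n k"
  let ?q = "walk_sgn \<theta> k"
  have N: "?N > 0" using n by simp
  have N\<theta>: "?N * \<theta> = 4"
    using N unfolding \<theta>_def by (subst times_divide_eq_right, subst nonzero_mult_div_cancel_left) linarith+
  have \<theta>: "0 \<le> \<theta>" "\<theta> \<le> 1" using n by (auto simp: \<theta>_def of_nat_diff)
  define F where "F e x y = ?q (int (swp e y) - int (swp e x)) - ?q (int y - int x)" for e x y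
  define d where "d x y = \<bar>?h x y - ?q (int y - int x)\<bar>" for x y
  have step: "\<bar>pair_order n (Suc k) x y - walk_sgn \<theta> (Suc k) (int y - int x)\<bar>
      \<le> ((\<Sum>e\<in>{1..<n}. d (swp e x) (swp e y)) + \<bar>F 0 x y\<bar> + \<bar>F n x y\<bar>) / ?N"
    if xy: "x \<in> {1..n}" "y \<in> {1..n}" for x y
  proof -
    let ?z = "int y - int x"
    have card: "(\<Sum>e\<in>{1..<n}. ?q ?z) = ?N * ?q ?z" by simp
    have "?N * walk_sgn \<theta> (Suc k) ?z = ?N * ?q ?z + 2 * (?q (?z + 1) + ?q (?z - 1) - 2 * ?q ?z)"
    proof -
      have "?N * walk_sgn \<theta> (Suc k) ?z = ?N * ?q ?z + (?N * \<theta>) * ((?q (?z + 1) + ?q (?z - 1)) / 2 - ?q ?z)"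
        unfolding walk_sgn_def lazy_walk.simps by algebra
      then show ?thesis unfolding N\<theta> by simp
    qed
    also have "2 * (?q (?z + 1) + ?q (?z - 1) - 2 * ?q ?z) = (\<Sum>e\<in>{1..<n}. F e x y) + F 0 x y + F n x y"
      unfolding F_def using sum_swp_difference[of ?q x n y] xy walk_sgn_odd by simp
    also have "(\<Sum>e\<in>{1..<n}. F e x y) = (\<Sum>e\<in>{1..<n}. ?q (int (swp e y) - int (swp e x))) - ?N * ?q ?z"
      unfolding F_def sum_subtractf card ..
    finally have w: "?N * walk_sgn \<theta> (Suc k) ?z
        = (\<Sum>e\<in>{1..<n}. ?q (int (swp e y) - int (swp e x))) + F 0 x y + F n x y"
      by simp
    have "?N * (pair_order n (Suc k) x y - walk_sgn \<theta> (Suc k) ?z)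
      = (\<Sum>e\<in>{1..<n}. ?h (swp e x) (swp e y)) - ?N * walk_sgn \<theta> (Suc k) ?z"
      using N by (simp add: right_diff_distrib)
    also have "\<dots> = (\<Sum>e\<in>{1..<n}. ?h (swp e x) (swp e y) - ?q (int (swp e y) - int (swp e x))) - F 0 x y
        - F n x y"
      unfolding w by (simp add: sum_subtractf)
    finally have eq: "?N * (pair_order n (Suc k) x y - walk_sgn \<theta> (Suc k) ?z) =
      (\<Sum>e\<in>{1..<n}. ?h (swp e x) (swp e y) - ?q (int (swp e y) - int (swp e x))) - F 0 x y - F n x y" .
    have "\<bar>?N * (pair_order n (Suc k) x y - walk_sgn \<theta> (Suc k) ?z)\<bar>
      \<le> (\<Sum>e\<in>{1..<n}. d (swp e x) (swp e y)) + \<bar>F 0 x y\<bar> + \<bar>F n x y\<bar>"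
    proof -
      have "\<bar>a - b - c\<bar> \<le> s + \<bar>b\<bar> + \<bar>c\<bar>" if "\<bar>a\<bar> \<le> s" for a b c s :: real
        using that by linarith
      from this[OF sum_abs] show ?thesis unfolding eq d_def .
    qed
    then have "\<bar>pair_order n (Suc k) x y - walk_sgn \<theta> (Suc k) ?z\<bar> * ?N
      \<le> (\<Sum>e\<in>{1..<n}. d (swp e x) (swp e y)) + \<bar>F 0 x y\<bar> + \<bar>F n x y\<bar>"
      unfolding abs_mult abs_of_pos[OF N] by (subst mult.commute)
    then show ?thesis unfolding pos_le_divide_eq[OF N] .
  qed
  have var: "(\<Sum>x\<in>{1..n}. \<bar>?q (g x + 1) - ?q (g x)\<bar>) \<le> 2" if "inj_on g {1..n}" for g
  proof -
    have "(\<Sum>x\<in>{1..n}. \<bar>?q (g x + 1) - ?q (g x)\<bar>) = (\<Sum>z\<in>g ` {1..n}. \<bar>?q (z + 1) - ?q z\<bar>)"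
      by (subst sum.reindex[OF that]) simp
    also have "\<dots> \<le> 2" by (intro walk_sgn_variation \<theta>) simp
    finally show ?thesis .
  qed
  \<comment> \<open>The fictitious swap matters only if one of the markers sits at the end location.
    On that row and on that column the terms are increments of \<open>walk_sgn\<close>, of total
    variation at most 2 each.\<close>
  have F0: "(\<Sum>x\<in>{1..n}. \<Sum>y\<in>{1..n}. \<bar>F 0 x y\<bar>) \<le> 4"
  proof -
    let ?a = "\<lambda>y. \<bar>?q (int y - 1 + 1) - ?q (int y - 1)\<bar>" and ?b = "\<lambda>x. \<bar>?q (- int x + 1) - ?q (- int x)\<bar>"
    have "(\<Sum>x\<in>{1..n}. \<Sum>y\<in>{1..n}. \<bar>F 0 x y\<bar>)
        \<le> (\<Sum>x\<in>{1..n}. \<Sum>y\<in>{1..n}. (if x = 1 then ?a y else 0) + (if y = 1 then ?b x else 0))"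
      by (intro sum_mono) (auto simp: F_def Transposition.transpose_def abs_minus_commute algebra_simps)
    also have "\<dots> = (\<Sum>y\<in>{1..n}. \<Sum>x\<in>{1..n}. if x = 1 then ?a y else 0)
        + (\<Sum>x\<in>{1..n}. \<Sum>y\<in>{1..n}. if y = 1 then ?b x else 0)"
      by (simp only: sum.distrib) (subst sum.swap, rule refl)
    also have "\<dots> = (\<Sum>y\<in>{1..n}. ?a y) + (\<Sum>x\<in>{1..n}. ?b x)"
      using n by (simp add: sum.delta)
    also have "\<dots> \<le> 2 + 2"
      by (intro add_mono var) (auto simp: inj_on_def)
    finally show ?thesis by simp
  qed
  have Fn: "(\<Sum>x\<in>{1..n}. \<Sum>y\<in>{1..n}. \<bar>F n x y\<bar>) \<le> 4"
  proof -
    let ?a = "\<lambda>y. \<bar>?q (int y - int n - 1 + 1) - ?q (int y - int n - 1)\<bar>"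
        and ?b = "\<lambda>x. \<bar>?q (int n - int x + 1) - ?q (int n - int x)\<bar>"
    have "(\<Sum>x\<in>{1..n}. \<Sum>y\<in>{1..n}. \<bar>F n x y\<bar>)
        \<le> (\<Sum>x\<in>{1..n}. \<Sum>y\<in>{1..n}. (if x = n then ?a y else 0) + (if y = n then ?b x else 0))"
      by (intro sum_mono) (auto simp: F_def Transposition.transpose_def abs_minus_commute algebra_simps)
    also have "\<dots> = (\<Sum>y\<in>{1..n}. \<Sum>x\<in>{1..n}. if x = n then ?a y else 0)
        + (\<Sum>x\<in>{1..n}. \<Sum>y\<in>{1..n}. if y = n then ?b x else 0)"
      by (simp only: sum.distrib) (subst sum.swap, rule refl)
    also have "\<dots> = (\<Sum>y\<in>{1..n}. ?a y) + (\<Sum>x\<in>{1..n}. ?b x)"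
      using n by (simp add: sum.delta)
    also have "\<dots> \<le> 2 + 2"
      by (intro add_mono var) (auto simp: inj_on_def)
    finally show ?thesis by simp
  qed
  have reindex: "(\<Sum>x\<in>{1..n}. \<Sum>y\<in>{1..n}. d (swp e x) (swp e y)) = (\<Sum>x\<in>{1..n}. \<Sum>y\<in>{1..n}. d x y)"
    if "e \<in> {1..<n}" for e
  proof -
    have "(\<Sum>x\<in>{1..n}. \<Sum>y\<in>{1..n}. d (swp e x) (swp e y)) = (\<Sum>x\<in>{1..n}. \<Sum>y\<in>{1..n}. d (swp e x) y)"
      by (intro sum.cong refl sum_swp[OF that])
    also have "\<dots> = (\<Sum>x\<in>{1..n}. \<Sum>y\<in>{1..n}. d x y)"
      by (rule sum_swp[OF that, where f = "\<lambda>x. \<Sum>y\<in>{1..n}. d x y"])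
    finally show ?thesis .
  qed
  have "(\<Sum>x\<in>{1..n}. \<Sum>y\<in>{1..n}. \<Sum>e\<in>{1..<n}. d (swp e x) (swp e y))
      = (\<Sum>x\<in>{1..n}. \<Sum>e\<in>{1..<n}. \<Sum>y\<in>{1..n}. d (swp e x) (swp e y))"
    by (intro sum.cong refl sum.swap)
  also have "\<dots> = (\<Sum>e\<in>{1..<n}. \<Sum>x\<in>{1..n}. \<Sum>y\<in>{1..n}. d (swp e x) (swp e y))"
    by (rule sum.swap)
  also have "\<dots> = ?N * (\<Sum>x\<in>{1..n}. \<Sum>y\<in>{1..n}. d x y)"
    by (subst sum.cong[OF refl reindex]) simp_all
  finally have dd: "(\<Sum>x\<in>{1..n}. \<Sum>y\<in>{1..n}. \<Sum>e\<in>{1..<n}. d (swp e x) (swp e y))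
      = ?N * (\<Sum>x\<in>{1..n}. \<Sum>y\<in>{1..n}. d x y)" .
  have "(\<Sum>x\<in>{1..n}. \<Sum>y\<in>{1..n}. \<bar>pair_order n (Suc k) x y - walk_sgn \<theta> (Suc k) (int y - int x)\<bar>)
    \<le> (\<Sum>x\<in>{1..n}. \<Sum>y\<in>{1..n}. ((\<Sum>e\<in>{1..<n}. d (swp e x) (swp e y)) + \<bar>F 0 x y\<bar> + \<bar>F n x y\<bar>) / ?N)"
    by (intro sum_mono step)
  also have "\<dots> = ((\<Sum>x\<in>{1..n}. \<Sum>y\<in>{1..n}. \<Sum>e\<in>{1..<n}. d (swp e x) (swp e y))
      + (\<Sum>x\<in>{1..n}. \<Sum>y\<in>{1..n}. \<bar>F 0 x y\<bar>) + (\<Sum>x\<in>{1..n}. \<Sum>y\<in>{1..n}. \<bar>F n x y\<bar>)) / ?N"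
    by (simp only: sum_divide_distrib[symmetric] sum.distrib)
  also have "\<dots> \<le> (?N * (2 * \<theta> * real k) + 4 + 4) / ?N"
    unfolding dd using F0 Fn Suc N
    by (intro divide_right_mono add_mono mult_left_mono) (auto simp: d_def)
  also have "\<dots> = 2 * \<theta> * real (Suc k)"
  proof -
    have "?N * (2 * \<theta> * real k) + 4 + 4 = ?N * (2 * \<theta> * real (Suc k))"
    proof -
      have "a * (2 * \<theta> * real k) + 2 * (a * \<theta>) = a * (2 * \<theta> * real (Suc k))" for a
        by (simp add: algebra_simps)
      from this[of ?N] show ?thesis unfolding N\<theta> by linarith
    qed
    then show ?thesis using N by simp
  qed
  finally show ?case .
qed

section \<open>Mean and variance of the number of inversions\<close>

definition inversions :: "nat \<Rightarrow> (nat \<Rightarrow> nat) \<Rightarrow> nat" where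
  "inversions n \<sigma> = (\<Sum>b\<in>{1..n}. \<Sum>a\<in>{1..<b}. of_bool (\<sigma> b < \<sigma> a))"

definition config :: "nat \<Rightarrow> (nat \<Rightarrow> nat) \<Rightarrow> bool" where
  "config n \<sigma> \<longleftrightarrow> bij_betw \<sigma> {1..n} {1..n}"

lemma adj_swap_apply: "adj_swap e \<sigma> a = swp e (\<sigma> a)"
  by (simp add: adj_swap_def)

lemma config_adj_swap: "e \<in> {1..<n} \<Longrightarrow> config n \<sigma> \<Longrightarrow> config n (adj_swap e \<sigma>)"
  unfolding config_def adj_swap_def by (rule bij_betw_trans) (auto simp: bij_betw_transpose_iff)

lemma config_id: "config n id"
  by (simp add: config_def)

fun walk_mean :: "nat \<Rightarrow> nat \<Rightarrow> ((nat \<Rightarrow> nat) \<Rightarrow> real) \<Rightarrow> (nat \<Rightarrow> nat) \<Rightarrow> real" where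
  "walk_mean n 0 g \<sigma> = g \<sigma>"
| "walk_mean n (Suc k) g \<sigma> = (\<Sum>e\<in>{1..<n}. walk_mean n k g (adj_swap e \<sigma>)) / real (n - 1)"

lemma walk_mean_const:
  assumes "2 \<le> n"
  shows "walk_mean n k (\<lambda>_. c) \<sigma> = c"
  using assms by (induction k arbitrary: \<sigma>) simp_all

lemma walk_mean_linear:
  "walk_mean n k (\<lambda>\<rho>. a * f \<rho> + b * g \<rho>) \<sigma> = a * walk_mean n k f \<sigma> + b * walk_mean n k g \<sigma>"
  by (induction k arbitrary: \<sigma>) (simp_all add: sum.distrib sum_distrib_left add_divide_distrib)

text \<open>The split of a mean square deviation into variance and squared bias. It recentres the
  second moment after the first swap has been fixed.\<close>

lemma walk_mean_square_shift:
  assumes "2 \<le> n"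
  shows "walk_mean n k (\<lambda>\<rho>. (g \<rho> - c)\<^sup>2) \<sigma> =
    walk_mean n k (\<lambda>\<rho>. (g \<rho> - walk_mean n k g \<sigma>)\<^sup>2) \<sigma> + (walk_mean n k g \<sigma> - c)\<^sup>2"
proof -
  let ?m = "walk_mean n k g \<sigma>"
  have sq: "walk_mean n k (\<lambda>\<rho>. (g \<rho> - c)\<^sup>2) \<sigma> = walk_mean n k (\<lambda>\<rho>. (g \<rho>)\<^sup>2) \<sigma> - 2 * c * ?m + c\<^sup>2" for c
  proof -
    have "(\<lambda>\<rho>. (g \<rho> - c)\<^sup>2) = (\<lambda>\<rho>. 1 * (g \<rho>)\<^sup>2 + 1 * ((- 2 * c) * g \<rho> + 1 * c\<^sup>2))"
      by (simp add: power2_eq_square algebra_simps fun_eq_iff)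
    then show ?thesis
      using assms by (simp only: walk_mean_linear walk_mean_const) simp
  qed
  show ?thesis unfolding sq by (simp add: power2_eq_square algebra_simps)
qed

text \<open>For distinct locations the inversion indicator is half of one minus the sign, and a pair
  evolves by itself, so linearity reduces the mean to \<open>pair_order\<close>.\<close>

lemma walk_mean_inversions:
  assumes "2 \<le> n" "config n \<sigma>"
  shows "walk_mean n k (\<lambda>\<rho>. real (inversions n \<rho>)) \<sigma> =
    (\<Sum>b\<in>{1..n}. \<Sum>a\<in>{1..<b}. (1 - pair_order n k (\<sigma> a) (\<sigma> b)) / 2)"
  using assms(2)
proof (induction k arbitrary: \<sigma>)
  case 0
  have "of_bool (\<sigma> b < \<sigma> a) = (1 - pair_order n 0 (\<sigma> a) (\<sigma> b)) / 2"
    if "b \<in> {1..n}" "a \<in> {1..<b}" for a b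
  proof -
    have "\<sigma> a \<noteq> \<sigma> b"
      using 0 that unfolding config_def bij_betw_def
          by (metis atLeastAtMost_iff atLeastLessThan_iff inj_on_eq_iff less_imp_le less_irrefl order_trans)
    then show ?thesis by (auto simp: sgn_if)
  qed
  then show ?case
    unfolding walk_mean.simps inversions_def of_nat_sum of_nat_of_bool by (intro sum.cong refl)
next
  case (Suc k)
  have N: "real (n - 1) > 0" using assms by simp
  have IH: "walk_mean n k (\<lambda>\<rho>. real (inversions n \<rho>)) (adj_swap e \<sigma>) =
      (\<Sum>b\<in>{1..n}. \<Sum>a\<in>{1..<b}. (1 - pair_order n k (swp e (\<sigma> a)) (swp e (\<sigma> b))) / 2)"
    if "e \<in> {1..<n}" for e
    by (rule trans[OF Suc.IH[OF config_adj_swap[OF that Suc.prems]]])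
      (intro sum.cong refl, simp only: adj_swap_apply)
  have "walk_mean n (Suc k) (\<lambda>\<rho>. real (inversions n \<rho>)) \<sigma> =
    (\<Sum>e\<in>{1..<n}. \<Sum>b\<in>{1..n}. \<Sum>a\<in>{1..<b}. (1 - pair_order n k (swp e (\<sigma> a)) (swp e (\<sigma> b))) / 2) / real (n - 1)"
    unfolding walk_mean.simps by (intro arg_cong2[where f = "(/)"] sum.cong refl IH)
  also have "(\<Sum>e\<in>{1..<n}. \<Sum>b\<in>{1..n}. \<Sum>a\<in>{1..<b}. (1 - pair_order n k (swp e (\<sigma> a)) (swp e (\<sigma> b))) / 2)
    = (\<Sum>b\<in>{1..n}. \<Sum>e\<in>{1..<n}. \<Sum>a\<in>{1..<b}. (1 - pair_order n k (swp e (\<sigma> a)) (swp e (\<sigma> b))) / 2)"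
    by (rule sum.swap)
  also have "\<dots> = (\<Sum>b\<in>{1..n}. \<Sum>a\<in>{1..<b}. \<Sum>e\<in>{1..<n}. (1 - pair_order n k (swp e (\<sigma> a)) (swp e (\<sigma> b))) / 2)"
    by (intro sum.cong refl sum.swap)
  also have "\<dots> / real (n - 1) = (\<Sum>b\<in>{1..n}. \<Sum>a\<in>{1..<b}.
      (\<Sum>e\<in>{1..<n}. (1 - pair_order n k (swp e (\<sigma> a)) (swp e (\<sigma> b))) / 2) / real (n - 1))"
    by (simp only: sum_divide_distrib)
  also have "\<dots> = (\<Sum>b\<in>{1..n}. \<Sum>a\<in>{1..<b}. (1 - pair_order n (Suc k) (\<sigma> a) (\<sigma> b)) / 2)"
  proof (intro sum.cong refl)
    fix a b
    have half: "(c - S) / 2 / c = (1 - S / c) / 2" if "0 < c" for c S :: real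
      using that by (simp add: field_simps)
    have eq: "(\<Sum>e\<in>{1..<n}. (1 - pair_order n k (swp e (\<sigma> a)) (swp e (\<sigma> b))) / 2)
      = (real (n - 1) - (\<Sum>e\<in>{1..<n}. pair_order n k (swp e (\<sigma> a)) (swp e (\<sigma> b)))) / 2"
      by (simp add: sum_subtractf flip: sum_divide_distrib)
    show "(\<Sum>e\<in>{1..<n}. (1 - pair_order n k (swp e (\<sigma> a)) (swp e (\<sigma> b))) / 2) / real (n - 1)
      = (1 - pair_order n (Suc k) (\<sigma> a) (\<sigma> b)) / 2"
      unfolding eq pair_order.simps by (rule half[OF N])
  qed
  finally show ?case .
qed

lemma walk_mean_inversions_change:
  assumes n: "7 \<le> n" and e: "e \<in> {1..<n}" and \<sigma>: "config n \<sigma>"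
  shows "\<bar>walk_mean n k (\<lambda>\<rho>. real (inversions n \<rho>)) (adj_swap e \<sigma>)
      - walk_mean n k (\<lambda>\<rho>. real (inversions n \<rho>)) \<sigma>\<bar> \<le> 4"
proof -
  let ?h = "pair_order n k"
  let ?D = "\<lambda>x y. \<bar>?h (swp e x) (swp e y) - ?h x y\<bar>"
  have n2: "2 \<le> n" using n by simp
  have eq: "walk_mean n k (\<lambda>\<rho>. real (inversions n \<rho>)) (adj_swap e \<sigma>)
      - walk_mean n k (\<lambda>\<rho>. real (inversions n \<rho>)) \<sigma>
    = (\<Sum>b\<in>{1..n}. \<Sum>a\<in>{1..<b}. (?h (\<sigma> a) (\<sigma> b) - ?h (swp e (\<sigma> a)) (swp e (\<sigma> b))) / 2)"
    unfolding walk_mean_inversions[OF n2 \<sigma>] walk_mean_inversions[OF n2 config_adj_swap[OF e \<sigma>]]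
        sum_subtractf[symmetric]
    by (intro sum.cong refl) (simp add: adj_swap_apply diff_divide_distrib)
  have "\<bar>walk_mean n k (\<lambda>\<rho>. real (inversions n \<rho>)) (adj_swap e \<sigma>) - walk_mean n k (\<lambda>\<rho>. real (inversions n \<rho>)) \<sigma>\<bar>
      \<le> (\<Sum>b\<in>{1..n}. \<Sum>a\<in>{1..<b}. \<bar>(?h (\<sigma> a) (\<sigma> b) - ?h (swp e (\<sigma> a)) (swp e (\<sigma> b))) / 2\<bar>)"
    unfolding eq by (rule order_trans[OF sum_abs], intro sum_mono sum_abs)
  also have "\<dots> = (\<Sum>b\<in>{1..n}. \<Sum>a\<in>{1..<b}. ?D (\<sigma> a) (\<sigma> b)) / 2"
    by (simp add: sum_divide_distrib abs_minus_commute)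
  \<comment> \<open>Extending to all pairs allows reindexing by the bijection
    \<open>\<sigma>\<close>, after which the configuration disappears and the bound 8 for location
    pairs applies, halved to 4.\<close>
  also have "\<dots> \<le> (\<Sum>b\<in>{1..n}. \<Sum>a\<in>{1..n}. ?D (\<sigma> a) (\<sigma> b)) / 2"
    by (intro divide_right_mono sum_mono sum_mono2) auto
  also have "(\<Sum>b\<in>{1..n}. \<Sum>a\<in>{1..n}. ?D (\<sigma> a) (\<sigma> b)) = (\<Sum>b\<in>{1..n}. \<Sum>x\<in>{1..n}. ?D x (\<sigma> b))"
    using \<sigma> unfolding config_def by (intro sum.cong refl sum.reindex_bij_betw)
  also have "\<dots> = (\<Sum>y\<in>{1..n}. \<Sum>x\<in>{1..n}. ?D x y)"
    using \<sigma> unfolding config_def by (rule sum.reindex_bij_betw)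
  also have "\<dots> = (\<Sum>x\<in>{1..n}. \<Sum>y\<in>{1..n}. ?D x y)"
    by (rule sum.swap)
  also have "\<dots> / 2 \<le> 8 / 2"
    by (intro divide_right_mono pair_order_swap_change[OF n e]) simp
  finally show ?thesis by simp
qed

text \<open>Conditioning on the first swap: the variance is the average of the remaining variances
  plus the variance of the conditional mean. The latter deviates by at most 8, so each swap costs at
  most \<open>8^2 = 64\<close>.\<close>

lemma walk_variance_inversions:
  assumes n: "7 \<le> n" and \<sigma>: "config n \<sigma>"
  shows "walk_mean n m (\<lambda>\<rho>. (real (inversions n \<rho>) - walk_mean n m (\<lambda>\<rho>. real (inversions n \<rho>)) \<sigma>)\<^sup>2) \<sigma>
      \<le> 64 * real m"
  using \<sigma>
proof (induction m arbitrary: \<sigma>)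
  case (Suc m)
  let ?g = "\<lambda>\<rho>. real (inversions n \<rho>)"
  let ?\<mu> = "walk_mean n m ?g"
  let ?N = "real (n - 1)"
  have n2: "2 \<le> n" and N: "?N > 0" using n by auto
  let ?c = "walk_mean n (Suc m) ?g \<sigma>"
  \<comment> \<open>Two conditional means differ by at most \<open>4 + 4\<close>, through their
    common value without the swap, and \<open>?c\<close> is the average of all of them.\<close>
  have dev: "\<bar>?\<mu> (adj_swap e \<sigma>) - ?c\<bar> \<le> 8" if e: "e \<in> {1..<n}" for e
  proof -
    have close: "\<bar>?\<mu> (adj_swap i \<sigma>) - ?\<mu> (adj_swap e \<sigma>)\<bar> \<le> 8" if "i \<in> {1..<n}" for i
      using walk_mean_inversions_change[OF n that Suc.prems, of m]
          walk_mean_inversions_change[OF n e Suc.prems, of m]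
      by linarith
    have sum_close: "\<bar>\<Sum>i\<in>{1..<n}. ?\<mu> (adj_swap i \<sigma>) - ?\<mu> (adj_swap e \<sigma>)\<bar> \<le> (\<Sum>i\<in>{1..<n}. 8)"
      by (rule order_trans[OF sum_abs], intro sum_mono close)
    have c: "?N * ?c = (\<Sum>i\<in>{1..<n}. ?\<mu> (adj_swap i \<sigma>))"
      unfolding walk_mean.simps using N by (subst times_divide_eq_right, subst nonzero_mult_div_cancel_left)
          linarith+
    have eq: "(\<Sum>i\<in>{1..<n}. ?\<mu> (adj_swap i \<sigma>) - ?\<mu> (adj_swap e \<sigma>)) = ?N * (?c - ?\<mu> (adj_swap e \<sigma>))"
      unfolding right_diff_distrib c sum_subtractf by simp
    have "?N * \<bar>?c - ?\<mu> (adj_swap e \<sigma>)\<bar> \<le> ?N * 8"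
      using sum_close[unfolded eq abs_mult abs_of_pos[OF N]] by (simp del: walk_mean.simps)
    then show ?thesis using N by (simp only: mult_le_cancel_left_pos abs_minus_commute)
  qed
  have "walk_mean n (Suc m) (\<lambda>\<rho>. (?g \<rho> - ?c)\<^sup>2) \<sigma>
      = (\<Sum>e\<in>{1..<n}. walk_mean n m (\<lambda>\<rho>. (?g \<rho> - ?c)\<^sup>2) (adj_swap e \<sigma>)) / ?N"
    by (simp only: walk_mean.simps)
  also have "\<dots> \<le> (\<Sum>e\<in>{1..<n}. 64 * real m + 64) / ?N"
  proof (intro divide_right_mono sum_mono)
    fix e assume e: "e \<in> {1..<n}"
    have "(?\<mu> (adj_swap e \<sigma>) - ?c)\<^sup>2 \<le> 8\<^sup>2"
      using dev[OF e] by (intro power2_le_iff_abs_le[THEN iffD2]) auto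
    then show "walk_mean n m (\<lambda>\<rho>. (?g \<rho> - ?c)\<^sup>2) (adj_swap e \<sigma>) \<le> 64 * real m + 64"
      unfolding walk_mean_square_shift[OF n2, of m ?g ?c "adj_swap e \<sigma>"]
      using Suc.IH[OF config_adj_swap[OF e Suc.prems]] by simp
  qed (use N in simp)
  also have "\<dots> = 64 * real (Suc m)" using N by simp
  finally show ?case .
qed simp

section \<open>Mean number of inversions started from the identity\<close>

lemma sum_over_differences:
  "(\<Sum>b\<in>{1..n}. \<Sum>a\<in>{1..<b}. f (b - a)) = (\<Sum>z\<in>{1..<n}. (real n - real z) * f z)"
proof (induction n)
  case (Suc n)
  have "(\<Sum>a\<in>{1..<Suc n}. f (Suc n - a)) = (\<Sum>z\<in>{1..<Suc n}. f z)"
    by (rule sum.reindex_bij_witness[of _ "\<lambda>z. Suc n - z" "\<lambda>a. Suc n - a"]) auto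
  moreover have "(\<Sum>z\<in>{1..<Suc n}. (real (Suc n) - real z) * f z)
    = (\<Sum>z\<in>{1..<Suc n}. (real n - real z) * f z) + (\<Sum>z\<in>{1..<Suc n}. f z)"
    by (simp add: sum.distrib[symmetric] algebra_simps)
  moreover have "(\<Sum>z\<in>{1..<Suc n}. (real n - real z) * f z) = (\<Sum>z\<in>{1..<n}. (real n - real z) * f z)"
    by (cases n) auto
  ultimately show ?case using Suc by simp
qed simp

text \<open>Replacing the expected signs by those of the walk on the line costs at most
  \<open>\<theta> * m\<close> after halving, and evaluating the weighted sum costs a further
  \<open>n / 2 + \<theta> * m\<close>.\<close>

lemma walk_mean_inversions_approx:
  assumes n: "5 \<le> n"
  defines "\<theta> \<equiv> 4 / real (n - 1)"
  shows "\<bar>walk_mean n m (\<lambda>\<rho>. real (inversions n \<rho>)) id - real n * walk_abs \<theta> m 0 / 2\<bar>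
      \<le> real n + 2 * (\<theta> * real m)"
proof -
  have n2: "2 \<le> n" and n1: "1 \<le> n" using n by auto
  have \<theta>: "0 \<le> \<theta>" "\<theta> \<le> 1" using n by (auto simp: \<theta>_def of_nat_diff)
  let ?d = "\<lambda>a b. pair_order n m a b - walk_sgn \<theta> m (int b - int a)"
  let ?W = "\<Sum>z\<in>{1..<n}. (real n - real z) * (1 - walk_sgn \<theta> m (int z))"
  have W: "?W = (\<Sum>b\<in>{1..n}. \<Sum>a\<in>{1..<b}. 1 - walk_sgn \<theta> m (int b - int a))"
    unfolding sum_over_differences[symmetric, of n "\<lambda>z. 1 - walk_sgn \<theta> m (int z)"]
    by (intro sum.cong refl) (auto simp: of_nat_diff)
  have "walk_mean n m (\<lambda>\<rho>. real (inversions n \<rho>)) id - ?W / 2 = - (\<Sum>b\<in>{1..n}. \<Sum>a\<in>{1..<b}. ?d a b) / 2"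
    unfolding walk_mean_inversions[OF n2 config_id] W sum_divide_distrib sum_subtractf[symmetric]
        sum_negf[symmetric]
    by (intro sum.cong refl) (simp add: field_simps)
  moreover have "\<bar>\<Sum>b\<in>{1..n}. \<Sum>a\<in>{1..<b}. ?d a b\<bar> \<le> 2 * \<theta> * real m"
  proof -
    have "\<bar>\<Sum>b\<in>{1..n}. \<Sum>a\<in>{1..<b}. ?d a b\<bar> \<le> (\<Sum>b\<in>{1..n}. \<Sum>a\<in>{1..<b}. \<bar>?d a b\<bar>)"
      by (rule order_trans[OF sum_abs], intro sum_mono sum_abs)
    also have "\<dots> \<le> (\<Sum>b\<in>{1..n}. \<Sum>a\<in>{1..n}. \<bar>?d a b\<bar>)"
      by (intro sum_mono sum_mono2) auto
    also have "\<dots> = (\<Sum>a\<in>{1..n}. \<Sum>b\<in>{1..n}. \<bar>?d a b\<bar>)"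
      by (rule sum.swap)
    also have "\<dots> \<le> 2 * \<theta> * real m"
      unfolding \<theta>_def by (rule pair_order_approx[OF n])
    finally show ?thesis .
  qed
  moreover have "\<bar>?W - real n * walk_abs \<theta> m 0\<bar> \<le> real n + 2 * (\<theta> * real m)"
    by (rule sum_weighted_walk_sgn[OF \<theta> n1])
  moreover have "0 \<le> \<theta> * real m" using \<theta> by simp
  ultimately show ?thesis by (simp add: field_simps)
qed

section \<open>Distance and inversions\<close>

text \<open>The particles \<open>p\<close> and \<open>q\<close> at the two exchanged locations form
  the only pair whose relative order changes.\<close>

lemma inversions_adj_swap:
  assumes e: "e \<in> {1..<n}" and \<sigma>: "config n \<sigma>"
  obtains p q where "p \<in> {1..n}" "q \<in> {1..n}" "p \<noteq> q" "\<sigma> p = e" "\<sigma> q = Suc e"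
    "p < q \<Longrightarrow> inversions n (adj_swap e \<sigma>) = Suc (inversions n \<sigma>)"
    "q < p \<Longrightarrow> inversions n \<sigma> = Suc (inversions n (adj_swap e \<sigma>))"
proof -
  have inj: "inj_on \<sigma> {1..n}" and im: "\<sigma> ` {1..n} = {1..n}"
    using \<sigma> by (auto simp: config_def bij_betw_def)
  have "e \<in> \<sigma> ` {1..n}" "Suc e \<in> \<sigma> ` {1..n}" unfolding im using e by auto
  then obtain p q where p: "p \<in> {1..n}" "\<sigma> p = e" and q: "q \<in> {1..n}" "\<sigma> q = Suc e"
    by (metis imageE)
  have pq: "p \<noteq> q" using p q by auto
  define P where "P = Sigma {1..n} (\<lambda>b. {1..<b})"
  have fin: "finite P" by (simp add: P_def)
  have inv: "inversions n \<rho> = (\<Sum>(b, a)\<in>P. of_bool (\<rho> b < \<rho> a))" for \<rho>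
    unfolding inversions_def P_def by (rule sum.Sigma) auto
  have unchanged: "swp e (\<sigma> b) < swp e (\<sigma> a) \<longleftrightarrow> \<sigma> b < \<sigma> a" if "(b, a) \<in> P" "{a, b} \<noteq> {p, q}" for a b
  proof -
    have ab: "a \<in> {1..n}" "b \<in> {1..n}" "a \<noteq> b" using that by (auto simp: P_def)
    have "\<sigma> c = e \<longleftrightarrow> c = p" "\<sigma> c = Suc e \<longleftrightarrow> c = q" if "c \<in> {1..n}" for c
      using inj_onD[OF inj, of c p] inj_onD[OF inj, of c q] p q that by auto
    note this[OF ab(1)] this[OF ab(2)]
    then show ?thesis using that(2) ab by (auto simp: Transposition.transpose_def)
  qed
  have change: "inversions n (adj_swap e \<sigma>) + of_bool (\<sigma> b < \<sigma> a)
      = inversions n \<sigma> + of_bool (swp e (\<sigma> b) < swp e (\<sigma> a))"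
    if "(b, a) \<in> P" "{a, b} = {p, q}" for a b
  proof -
    have "(\<Sum>(b, a)\<in>P - {(b, a)}. of_bool (adj_swap e \<sigma> b < adj_swap e \<sigma> a))
        = (\<Sum>(b, a)\<in>P - {(b, a)}. of_bool (\<sigma> b < \<sigma> a) :: nat)"
    proof (intro sum.cong refl)
      fix x assume "x \<in> P - {(b, a)}"
      then obtain b' a' where x: "x = (b', a')" and *: "(b', a') \<in> P" "\<not> (b' = b \<and> a' = a)"
        by (cases x) auto
      have "{a', b'} \<noteq> {p, q}" using * that by (auto simp: P_def doubleton_eq_iff)
      from unchanged[OF *(1) this] show "(\<lambda>(b, a). of_bool (adj_swap e \<sigma> b < adj_swap e \<sigma> a)) x
          = ((\<lambda>(b, a). of_bool (\<sigma> b < \<sigma> a)) x :: nat)"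
        by (simp add: x adj_swap_apply)
    qed
    then show ?thesis
      unfolding inv sum.remove[OF fin that(1)] by (simp add: adj_swap_apply)
  qed
  show ?thesis
  proof (rule that[OF p(1) q(1) pq p(2) q(2)])
    assume "p < q"
    then show "inversions n (adj_swap e \<sigma>) = Suc (inversions n \<sigma>)"
      using change[of q p] p q by (auto simp: P_def)
  next
    assume "q < p"
    then show "inversions n \<sigma> = Suc (inversions n (adj_swap e \<sigma>))"
      using change[of p q] p q by (auto simp: P_def insert_commute)
  qed
qed

lemma inversions_adj_swap_le:
  assumes "e \<in> {1..<n}" "config n \<sigma>"
  shows "\<bar>int (inversions n (adj_swap e \<sigma>)) - int (inversions n \<sigma>)\<bar> \<le> 1"
proof (rule inversions_adj_swap[OF assms])
  fix p q :: nat
  assume "p \<noteq> q" "p < q \<Longrightarrow> inversions n (adj_swap e \<sigma>) = Suc (inversions n \<sigma>)"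
    "q < p \<Longrightarrow> inversions n \<sigma> = Suc (inversions n (adj_swap e \<sigma>))"
  then show ?thesis by (cases p q rule: linorder_cases) auto
qed

lemma no_descent_imp_id:
  assumes \<sigma>: "config n \<sigma>" and out: "\<And>x. x \<notin> {1..n} \<Longrightarrow> \<sigma> x = x"
    and asc: "\<And>e p q. e \<in> {1..<n} \<Longrightarrow> p \<in> {1..n} \<Longrightarrow> q \<in> {1..n} \<Longrightarrow> \<sigma> p = e \<Longrightarrow> \<sigma> q = Suc e \<Longrightarrow> p < q"
  shows "\<sigma> = id"
proof -
  define \<tau> where "\<tau> = inv_into {1..n} \<sigma>"
  have bij: "bij_betw \<sigma> {1..n} {1..n}" using \<sigma> by (simp add: config_def)
  have \<tau>: "\<tau> y \<in> {1..n}" "\<sigma> (\<tau> y) = y" if "y \<in> {1..n}" for y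
    using that bij unfolding \<tau>_def bij_betw_def by (metis inv_into_into, metis f_inv_into_f)
  have inc: "\<tau> e < \<tau> (Suc e)" if "e \<in> {1..<n}" for e
    using that asc[OF that] \<tau>[of e] \<tau>[of "Suc e"] by auto
  \<comment> \<open>The inverse \<open>\<tau>\<close> is strictly increasing: climbing from 1 gives
    \<open>y \<le> \<tau> y\<close>, descending from \<open>n\<close> gives the reverse
    inequality.\<close>
  have ge: "y \<le> \<tau> y" if "1 \<le> y" "y \<le> n" for y
    using that
  proof (induction y rule: dec_induct)
    case base
    then show ?case using \<tau>(1)[of 1] by auto
  next
    case (step y)
    then show ?case using inc[of y] by auto
  qed
  have le: "\<tau> y \<le> y" if "y \<le> n" "1 \<le> y" for y
    using that
  proof (induction y rule: inc_induct)
    case base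
    then show ?case using \<tau>(1)[of n] by auto
  next
    case (step y)
    then show ?case using inc[of y] by auto
  qed
  have "\<sigma> x = x" for x
  proof (cases "x \<in> {1..n}")
    case True
    then have "\<tau> x = x" using ge[of x] le[of x] by auto
    then show ?thesis using \<tau>(2)[OF True] by simp
  qed (rule out)
  then show ?thesis by auto
qed

lemma adj_swaps_snoc: "adj_swaps (ks @ [e]) = adj_swap e (adj_swaps ks)"
  by (simp add: adj_swaps_def)

lemma config_adj_swaps: "set ks \<subseteq> {1..<n} \<Longrightarrow> config n (adj_swaps ks)"
  by (induction ks rule: rev_induct) (auto simp: adj_swaps_snoc config_adj_swap, simp add: adj_swaps_def
      config_id)

lemma adj_swaps_outside: "set ks \<subseteq> {1..<n} \<Longrightarrow> x \<notin> {1..n} \<Longrightarrow> adj_swaps ks x = x"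
  by (induction ks rule: rev_induct) (auto simp: adj_swaps_snoc adj_swap_apply Transposition.transpose_def,
      simp_all add: adj_swaps_def)

lemma adj_swap_involution [simp]: "adj_swap e (adj_swap e \<sigma>) = \<sigma>"
  by (simp add: adj_swap_def fun_eq_iff)

lemma inversions_id [simp]: "inversions n id = 0"
  by (simp add: inversions_def)

text \<open>Bubble sort: unless the configuration is the identity, some two neighbouring locations
  hold particles in the wrong order, and exchanging them removes exactly one inversion.\<close>

lemma exists_adj_swaps:
  assumes "config n \<sigma>" "\<And>x. x \<notin> {1..n} \<Longrightarrow> \<sigma> x = x"
  shows "\<exists>ks. length ks = inversions n \<sigma> \<and> set ks \<subseteq> {1..<n} \<and> adj_swaps ks = \<sigma>"
  using assms
proof (induction "inversions n \<sigma>" arbitrary: \<sigma> rule: less_induct)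
  case less
  show ?case
  proof (cases "\<sigma> = id")
    case True
    then show ?thesis by (intro exI[of _ "[]"]) (simp add: adj_swaps_def)
  next
    case False
    then obtain e p q where e: "e \<in> {1..<n}" "p \<in> {1..n}" "q \<in> {1..n}" "\<sigma> p = e" "\<sigma> q = Suc e" "\<not> p < q"
      using no_descent_imp_id[OF less.prems] by blast
    obtain p' q' where pq: "p' \<in> {1..n}" "q' \<in> {1..n}" "p' \<noteq> q'" "\<sigma> p' = e" "\<sigma> q' = Suc e"
      and desc: "q' < p' \<Longrightarrow> inversions n \<sigma> = Suc (inversions n (adj_swap e \<sigma>))"
      using inversions_adj_swap[OF e(1) less.prems(1)] by metis
    have inj: "inj_on \<sigma> {1..n}" using less.prems(1) by (auto simp: config_def bij_betw_def)
    have "p' = p" "q' = q" using inj_onD[OF inj, of p' p] inj_onD[OF inj, of q' q] pq e by auto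
    with desc e(6) pq(3) have inv: "inversions n \<sigma> = Suc (inversions n (adj_swap e \<sigma>))" by auto
    have out: "adj_swap e \<sigma> x = x" if "x \<notin> {1..n}" for x
      using less.prems(2)[OF that] e(1) that by (auto simp: adj_swap_apply Transposition.transpose_def)
    obtain ks where "length ks = inversions n (adj_swap e \<sigma>)" "set ks \<subseteq> {1..<n}" "adj_swaps ks = adj_swap e \<sigma>"
      using less.hyps[OF _ config_adj_swap[OF e(1) less.prems(1)] out] inv by auto
    then show ?thesis
      using e(1) inv by (intro exI[of _ "ks @ [e]"]) (auto simp: adj_swaps_snoc)
  qed
qed

lemma inversions_adj_swaps_append:
  assumes "set xs \<subseteq> {1..<n}" "set ys \<subseteq> {1..<n}"
  shows "\<bar>int (inversions n (adj_swaps (xs @ ys))) - int (inversions n (adj_swaps xs))\<bar> \<le> int (length ys)"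
  using assms(2)
proof (induction ys rule: rev_induct)
  case (snoc y ys)
  have "config n (adj_swaps (xs @ ys))" using assms snoc.prems by (intro config_adj_swaps) auto
  from inversions_adj_swap_le[OF _ this, of y] show ?case
    using snoc adj_swaps_snoc[of "xs @ ys" y] by auto
qed simp

text \<open>Bubble sort attains this length, and no shorter word can do so because each swap changes
  the count by at most one.\<close>

lemma adj_dist_eq_inversions:
  assumes "set ks \<subseteq> {1..<n}"
  shows "adj_dist n (adj_swaps ks) = inversions n (adj_swaps ks)"
  unfolding adj_dist_def
proof (rule Least_equality)
  show "\<exists>ks'. length ks' = inversions n (adj_swaps ks) \<and> set ks' \<subseteq> {1..<n} \<and> adj_swaps ks' = adj_swaps ks"
    using config_adj_swaps[OF assms] adj_swaps_outside[OF assms] by (rule exists_adj_swaps)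
next
  fix m assume "\<exists>ks'. length ks' = m \<and> set ks' \<subseteq> {1..<n} \<and> adj_swaps ks' = adj_swaps ks"
  then obtain ks' where ks': "length ks' = m" "set ks' \<subseteq> {1..<n}" "adj_swaps ks' = adj_swaps ks" by blast
  have "inversions n (adj_swaps []) = 0" by (simp add: adj_swaps_def)
  then show "inversions n (adj_swaps ks) \<le> m"
    using inversions_adj_swaps_append[of "[]" n ks'] ks' by simp
qed

lemma adj_dist_prefix:
  assumes "\<And>k. f k \<in> {1..<n}"
  shows "\<bar>real (adj_dist n (adj_swaps (map f [0..<N]))) - real (inversions n (adj_swaps (map f [0..<m])))\<bar>
      \<le> \<bar>real N - real m\<bar>"
proof -
  have *: "\<bar>int (inversions n (adj_swaps (map f [0..<j]))) - int (inversions n (adj_swaps (map f [0..<i])))\<bar>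
      \<le> int j - int i"
    if "i \<le> j" for i j
  proof -
    have "[0..<j] = [0..<i] @ [i..<j]" using that by (metis le_add_diff_inverse upt_add_eq_append zero_le)
    moreover have "set (map f xs) \<subseteq> {1..<n}" for xs
      unfolding set_map by (rule image_subsetI, rule assms)
    note inversions_adj_swaps_append[OF this[of "[0..<i]"] this[of "[i..<j]"]]
    ultimately show ?thesis using that by (simp add: of_nat_diff)
  qed
  have "adj_dist n (adj_swaps (map f [0..<N])) = inversions n (adj_swaps (map f [0..<N]))"
    using assms by (intro adj_dist_eq_inversions) auto
  then show ?thesis using *[of N m] *[of m N] by linarith
qed

section \<open>Swap words of fixed length and Chebyshev's inequality by counting\<close>

definition swap_lists :: "nat \<Rightarrow> nat \<Rightarrow> nat list set" where
  "swap_lists n m = {ks. set ks \<subseteq> {1..<n} \<and> length ks = m}"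

lemma finite_swap_lists: "finite (swap_lists n m)"
  unfolding swap_lists_def by (rule finite_lists_length_eq) simp

lemma sum_swap_lists:
  assumes "2 \<le> n"
  shows "(\<Sum>ks\<in>swap_lists n m. g (fold adj_swap ks \<sigma>)) = real (n - 1) ^ m * walk_mean n m g \<sigma>"
proof (induction m arbitrary: \<sigma>)
  case 0
  have "swap_lists n 0 = {[]}" by (auto simp: swap_lists_def)
  then show ?case by simp
next
  case (Suc m)
  have "swap_lists n (Suc m) = (\<lambda>(xs, e). e # xs) ` (swap_lists n m \<times> {1..<n})"
    unfolding swap_lists_def by (rule lists_length_Suc_eq)
  then have "(\<Sum>ks\<in>swap_lists n (Suc m). g (fold adj_swap ks \<sigma>))
      = (\<Sum>(xs, e)\<in>swap_lists n m \<times> {1..<n}. g (fold adj_swap xs (adj_swap e \<sigma>)))"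
    by (simp add: sum.reindex inj_on_def case_prod_unfold)
  also have "\<dots> = (\<Sum>e\<in>{1..<n}. \<Sum>xs\<in>swap_lists n m. g (fold adj_swap xs (adj_swap e \<sigma>)))"
    unfolding sum.cartesian_product[symmetric] by (rule sum.swap)
  also have "\<dots> = real (n - 1) ^ m * (\<Sum>e\<in>{1..<n}. walk_mean n m g (adj_swap e \<sigma>))"
    unfolding Suc by (rule sum_distrib_left[symmetric])
  finally show ?case using assms by simp
qed

text \<open>Chebyshev's inequality for a uniformly chosen word, in terms of cardinalities;
  probability enters only through the law of the word of locations.\<close>

lemma card_swap_lists_deviation:
  fixes n m :: nat
  assumes n: "7 \<le> n" and \<eta>: "0 < \<eta>"
  defines "\<mu> \<equiv> walk_mean n m (\<lambda>\<rho>. real (inversions n \<rho>)) id"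
  shows "real (card {ks \<in> swap_lists n m. \<eta> \<le> \<bar>real (inversions n (adj_swaps ks)) - \<mu>\<bar>}) / real (n - 1) ^ m
      \<le> 64 * real m / \<eta>\<^sup>2"
proof -
  let ?B = "{ks \<in> swap_lists n m. \<eta> \<le> \<bar>real (inversions n (adj_swaps ks)) - \<mu>\<bar>}"
  let ?N = "real (n - 1) ^ m"
  have N: "?N > 0" using n by simp
  have "\<eta>\<^sup>2 * real (card ?B) = (\<Sum>ks\<in>?B. \<eta>\<^sup>2)" by simp
  also have "\<dots> \<le> (\<Sum>ks\<in>?B. (real (inversions n (adj_swaps ks)) - \<mu>)\<^sup>2)"
    using \<eta> by (intro sum_mono) (auto simp: abs_le_square_iff[symmetric])
  also have "\<dots> \<le> (\<Sum>ks\<in>swap_lists n m. (real (inversions n (adj_swaps ks)) - \<mu>)\<^sup>2)"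
    by (intro sum_mono2 finite_swap_lists) auto
  also have "\<dots> = ?N * walk_mean n m (\<lambda>\<rho>. (real (inversions n \<rho>) - \<mu>)\<^sup>2) id"
    unfolding adj_swaps_def using n by (intro sum_swap_lists) simp
  also have "\<dots> \<le> ?N * (64 * real m)"
    unfolding \<mu>_def using N walk_variance_inversions[OF n config_id] by (intro mult_left_mono) auto
  finally show ?thesis using N \<eta> by (simp add: field_simps)
qed

section \<open>The Poisson clock\<close>

context adjacent_transposition_clock
begin

lemma location_prob:
  "prob (I k -` A \<inter> space M) = real (card ({1..<n} \<inter> A)) / real (n - 1)"
proof -
  have "prob (I k -` A \<inter> space M) = measure (distr M (count_space UNIV) (I k)) A"
    using location_measurable[of k] by (simp add: measure_distr)
  also have "\<dots> = real (card ({1..<n} \<inter> A)) / real (card {1..<n})"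
    unfolding location_uniform using n_ge_2 by (intro measure_pmf_of_set) auto
  finally show ?thesis by simp
qed

lemma AE_location: "AE \<omega> in M. \<forall>k. I k \<omega> \<in> {1..<n}"
proof -
  have "AE \<omega> in M. I k \<omega> \<in> {1..<n}" for k
  proof -
    have "prob (I k -` {1..<n} \<inter> space M) = 1"
      using location_prob[of k "{1..<n}"] n_ge_2 by simp
    moreover have "I k -` {1..<n} \<inter> space M \<in> events"
      using location_measurable[of k] by (auto intro: measurable_sets)
    ultimately have "AE \<omega> in M. \<omega> \<in> I k -` {1..<n} \<inter> space M"
      by (simp only: prob_eq_1)
    then show ?thesis by eventually_elim simp
  qed
  then show ?thesis by (simp add: AE_all_countable)
qed

lemma AE_holding_time: "AE \<omega> in M. \<forall>k. 0 \<le> E k \<omega>"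
proof -
  have "AE \<omega> in M. 0 \<le> E k \<omega>" for k
  proof -
    have "prob {\<omega> \<in> space M. 0 < E k \<omega>} = 1"
      using exponential_distributedD_gt[OF holding_time[of k], of 0] by simp
    moreover have "{\<omega> \<in> space M. 0 < E k \<omega>} \<in> events"
      using distributed_measurable[OF holding_time[of k]] by measurable
    ultimately have "AE \<omega> in M. \<omega> \<in> {\<omega> \<in> space M. 0 < E k \<omega>}"
      by (simp only: prob_eq_1)
    then show ?thesis by eventually_elim simp
  qed
  then show ?thesis by (simp add: AE_all_countable)
qed

lemma location_list_event: "{\<omega> \<in> space M. map (\<lambda>k. I k \<omega>) [0..<m] = ks} \<in> events"
proof (cases "length ks = m")
  case True
  have "{\<omega> \<in> space M. map (\<lambda>k. I k \<omega>) [0..<m] = ks} = {\<omega> \<in> space M. \<forall>k<m. I k \<omega> = ks ! k}"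
    using True by (auto simp: list_eq_iff_nth_eq)
  also have "\<dots> \<in> events"
    using location_measurable by measurable
  finally show ?thesis .
next
  case False
  then have empty: "{\<omega> \<in> space M. map (\<lambda>k. I k \<omega>) [0..<m] = ks} = {}" by auto
  show ?thesis unfolding empty by simp
qed

lemma location_list_prob:
  assumes "ks \<in> swap_lists n m"
  shows "prob {\<omega> \<in> space M. map (\<lambda>k. I k \<omega>) [0..<m] = ks} = 1 / real (n - 1) ^ m"
proof (cases "m = 0")
  case True
  then show ?thesis using assms by (simp add: swap_lists_def prob_space)
next
  case False
  have len: "length ks = m" and sub: "set ks \<subseteq> {1..<n}"
    using assms by (auto simp: swap_lists_def)
  have ks: "ks ! k \<in> {1..<n}" if "k < m" for k
    by (rule subsetD[OF sub nth_mem]) (simp add: len that)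
  let ?X = "case_sum E (\<lambda>k \<omega>. real (I k \<omega>))"
  let ?A = "case_sum (\<lambda>_. UNIV) (\<lambda>k. {real (ks ! k)})"
  \<comment> \<open>In the joint family the locations carry the tag \<open>Inr\<close>. The product
    formula needs a nonempty index set, which is why the empty word is treated separately.\<close>
  define J :: "(nat + nat) set" where "J = Inr ` {..<m}"
  have J: "J \<noteq> {}" "finite J" "J \<subseteq> UNIV" using False by (auto simp: J_def lessThan_empty_iff)
  have A: "?A j \<in> sets borel" if "j \<in> J" for j
    using that by (auto simp: J_def)
  have "{\<omega> \<in> space M. map (\<lambda>k. I k \<omega>) [0..<m] = ks} = (\<Inter>k\<in>{..<m}. {\<omega> \<in> space M. I k \<omega> = ks ! k})"
    using len False by (auto simp: list_eq_iff_nth_eq)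
  also have "\<dots> = (\<Inter>j\<in>J. ?X j -` ?A j \<inter> space M)"
    unfolding J_def by auto
  also have "prob \<dots> = (\<Prod>j\<in>J. prob (?X j -` ?A j \<inter> space M))"
    by (rule indep_varsD[OF indep_clock J A])
  also have "\<dots> = (\<Prod>k<m. prob (I k -` {ks ! k} \<inter> space M))"
    unfolding J_def by (subst prod.reindex) (auto intro!: prod.cong arg_cong[where f = prob])
  also have "\<dots> = (\<Prod>k<m. 1 / real (n - 1))"
    using ks by (intro prod.cong refl) (simp add: location_prob)
  finally show ?thesis by (simp add: power_one_over)
qed

lemma location_lists_event: "finite B \<Longrightarrow> {\<omega> \<in> space M. map (\<lambda>k. I k \<omega>) [0..<m] \<in> B} \<in> events"
proof -
  assume "finite B"
  then have "(\<Union>ks\<in>B. {\<omega> \<in> space M. map (\<lambda>k. I k \<omega>) [0..<m] = ks}) \<in> events"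
    by (intro sets.finite_UN location_list_event)
  then show ?thesis by (simp add: UNION_eq Collect_bex_eq[symmetric] conj_commute)
qed

lemma location_lists_prob_le:
  assumes "B \<subseteq> swap_lists n m"
  shows "prob {\<omega> \<in> space M. map (\<lambda>k. I k \<omega>) [0..<m] \<in> B} \<le> real (card B) / real (n - 1) ^ m"
proof -
  have fin: "finite B" using assms finite_swap_lists by (rule finite_subset)
  have "{\<omega> \<in> space M. map (\<lambda>k. I k \<omega>) [0..<m] \<in> B} = (\<Union>ks\<in>B. {\<omega> \<in> space M. map (\<lambda>k. I k \<omega>) [0..<m] = ks})"
    by auto
  also have "prob \<dots> \<le> (\<Sum>ks\<in>B. prob {\<omega> \<in> space M. map (\<lambda>k. I k \<omega>) [0..<m] = ks})"
    by (intro finite_measure_subadditive_finite fin) (auto intro: location_list_event)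
  also have "\<dots> = (\<Sum>ks\<in>B. 1 / real (n - 1) ^ m)"
    using assms by (intro sum.cong refl location_list_prob) auto
  finally show ?thesis by simp
qed

section \<open>Ring times and concentration of the number of rings\<close>

definition ring_time :: "nat \<Rightarrow> 'a \<Rightarrow> real" where
  "ring_time k \<omega> = (\<Sum>j\<le>k. E j \<omega>)"

lemma ring_time_distributed: "distributed M lborel (ring_time k) (erlang_density k 1)"
proof -
  let ?X = "case_sum E (\<lambda>k \<omega>. real (I k \<omega>))"
  have "indep_vars (\<lambda>_. borel) ?X (Inl ` {..k})"
    by (rule indep_vars_subset[OF indep_clock]) simp
  then have "distributed M lborel (\<lambda>\<omega>. \<Sum>i\<in>Inl ` {..k}. ?X i \<omega>)
      (erlang_density (card (Inl ` {..k} :: (nat + nat) set) - 1) 1)"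
    by (intro exponential_distributed_sum) (auto intro: holding_time)
  then show ?thesis
    by (simp add: ring_time_def[abs_def] sum.reindex card_image)
qed

lemma ring_time_measurable: "ring_time k \<in> borel_measurable M"
  using distributed_measurable[OF ring_time_distributed] by simp

lemma ring_time_deviation:
  assumes "0 < a"
  shows "prob {\<omega> \<in> space M. a \<le> \<bar>ring_time k \<omega> - real (Suc k)\<bar>} \<le> real (Suc k) / a\<^sup>2"
proof -
  have "expectation (ring_time k) = real (Suc k)"
    using erlang_ith_moment[OF _ ring_time_distributed[of k], of 1] by simp
  moreover have "variance (ring_time k) = real (Suc k)"
    using erlang_distributed_variance[OF _ ring_time_distributed[of k]] by simp
  moreover have "integrable M (\<lambda>\<omega>. (ring_time k \<omega>)\<^sup>2)"
    by (rule erlang_ith_moment_integrable[OF _ ring_time_distributed]) simp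
  ultimately show ?thesis
    using Chebyshev_inequality[OF ring_time_measurable, of k a] assms by simp
qed

lemma clock_rings_bounds:
  assumes E: "\<And>k. 0 \<le> E k \<omega>" and hi: "t < ring_time a \<omega>" and lo: "ring_time b \<omega> \<le> t"
  shows "clock_rings E t \<omega> \<le> a" "b < clock_rings E t \<omega>"
proof -
  have mono: "ring_time i \<omega> \<le> ring_time j \<omega>" if "i \<le> j" for i j
    unfolding ring_time_def using that E by (intro sum_mono2) auto
  let ?K = "{k. ring_time k \<omega> \<le> t}"
  have K: "clock_rings E t \<omega> = card ?K" by (simp add: clock_rings_def ring_time_def)
  \<comment> \<open>Ring times are nondecreasing, so no ring from \<open>a\<close> on has occurred.
    This also makes the set finite, so that \<open>card\<close> really counts the rings.\<close>
  have sub: "?K \<subseteq> {..<a}"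
  proof
    fix k assume "k \<in> ?K"
    then show "k \<in> {..<a}" using hi mono[of a k] by (cases "a \<le> k") auto
  qed
  then show "clock_rings E t \<omega> \<le> a" unfolding K by (metis card_lessThan card_mono finite_lessThan)
  have "{..b} \<subseteq> ?K" using lo mono by (auto intro: order_trans)
  then have "card {..b} \<le> card ?K" using sub by (intro card_mono) (auto intro: finite_subset)
  then show "b < clock_rings E t \<omega>" unfolding K by simp
qed

text \<open>Almost surely \<open>A\<close> is covered by three events: the first \<open>m\<close>
  swaps give an untypical number of inversions, or one of two ring times is off by at least
  \<open>L\<close>. Outside them the number of rings is within \<open>L\<close> of \<open>m\<close>,
  which moves the distance by at most \<open>L\<close>.\<close>

lemma walk_distance_deviation:
  assumes n: "7 \<le> n" and t: "real m \<le> t" "t \<le> real m + 1" and L: "0 < L" "L < m" and \<eta>: "0 < \<eta>"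
  defines "\<mu> \<equiv> walk_mean n m (\<lambda>\<rho>. real (inversions n \<rho>)) id"
  assumes A: "A \<subseteq> {\<omega> \<in> space M. \<eta> + real L < \<bar>real (walk_distance n E I t \<omega>) - \<mu>\<bar>}"
  shows "prob A
    \<le> 64 * real m / \<eta>\<^sup>2 + 2 * (real m + real L + 1) / (real L)\<^sup>2"
proof -
  define B where "B = {ks \<in> swap_lists n m. \<eta> \<le> \<bar>real (inversions n (adj_swaps ks)) - \<mu>\<bar>}"
  \<comment> \<open>Rings are counted from 0, so ring \<open>b\<close> has mean time
    \<open>m - L\<close> and ring \<open>a\<close> has mean time \<open>m + L + 1\<close>. With
    deviations below \<open>L\<close> they fall on either side of \<open>t\<close>, for any
    \<open>t\<close> between \<open>m\<close> and \<open>m + 1\<close>.\<close>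
  define b where "b = m - L - 1"
  define a where "a = m + L"
  define U1 where "U1 = {\<omega> \<in> space M. map (\<lambda>k. I k \<omega>) [0..<m] \<in> B}"
  define U2 where "U2 = {\<omega> \<in> space M. real L \<le> \<bar>ring_time a \<omega> - real (Suc a)\<bar>}"
  define U3 where "U3 = {\<omega> \<in> space M. real L \<le> \<bar>ring_time b \<omega> - real (Suc b)\<bar>}"
  have b: "real (Suc b) = real m - real L" using L by (simp add: b_def of_nat_diff)
  have B_sub: "B \<subseteq> swap_lists n m" by (auto simp: B_def)
  have U1: "U1 \<in> events"
    unfolding U1_def using B_sub finite_swap_lists by (intro location_lists_event) (rule finite_subset)
  have U23: "U2 \<in> events" "U3 \<in> events"
    unfolding U2_def U3_def using ring_time_measurable by measurable
  have "prob A \<le> prob (U1 \<union> U2 \<union> U3)"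
  proof (rule finite_measure_mono_AE)
    show "AE \<omega> in M. \<omega> \<in> A \<longrightarrow> \<omega> \<in> U1 \<union> U2 \<union> U3"
      using AE_location AE_holding_time
    proof eventually_elim
      case (elim \<omega>)
      show ?case
      proof (intro impI, rule ccontr)
        assume "\<omega> \<in> A" and "\<omega> \<notin> U1 \<union> U2 \<union> U3"
        then have far: "\<omega> \<in> {\<omega> \<in> space M. \<eta> + real L < \<bar>real (walk_distance n E I t \<omega>) - \<mu>\<bar>}" and
          out: "map (\<lambda>k. I k \<omega>) [0..<m] \<notin> B" "\<bar>ring_time a \<omega> - real (Suc a)\<bar> < real L"
              "\<bar>ring_time b \<omega> - real (Suc b)\<bar> < real L"
          using A by (auto simp: U1_def U2_def U3_def)
        have "t < ring_time a \<omega>" using out(2) t by (simp add: a_def)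
        moreover have "ring_time b \<omega> \<le> t" using out(3) t b by simp
        ultimately have "clock_rings E t \<omega> \<le> a" "b < clock_rings E t \<omega>"
          using clock_rings_bounds elim(2) by blast+
        then have "\<bar>real (clock_rings E t \<omega>) - real m\<bar> \<le> real L"
          using b by (simp add: a_def)
        moreover have "map (\<lambda>k. I k \<omega>) [0..<m] \<in> swap_lists n m"
          using elim(1) by (auto simp: swap_lists_def)
        with out(1) have "\<bar>real (inversions n (adj_swaps (map (\<lambda>k. I k \<omega>) [0..<m]))) - \<mu>\<bar> < \<eta>"
          by (simp add: B_def)
        moreover have "\<bar>real (walk_distance n E I t \<omega>)
            - real (inversions n (adj_swaps (map (\<lambda>k. I k \<omega>) [0..<m])))\<bar>
            \<le> \<bar>real (clock_rings E t \<omega>) - real m\<bar>"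
          unfolding walk_distance_def transposition_walk_def using elim(1) by (intro adj_dist_prefix) blast
        moreover have "\<eta> + real L < \<bar>real (walk_distance n E I t \<omega>) - \<mu>\<bar>" using far by simp
        ultimately show False by linarith
      qed
    qed
    show "U1 \<union> U2 \<union> U3 \<in> events" using U1 U23 by auto
  qed
  also have "\<dots> \<le> prob U1 + prob U2 + prob U3"
    by (rule order_trans[OF measure_Un_le]) (use U1 U23 in \<open>auto intro: measure_Un_le\<close>)
  also have "\<dots> \<le> 64 * real m / \<eta>\<^sup>2 + real (Suc a) / (real L)\<^sup>2 + real (Suc b) / (real L)\<^sup>2"
  proof (intro add_mono)
    have "prob U1 \<le> real (card B) / real (n - 1) ^ m"
      unfolding U1_def by (rule location_lists_prob_le[OF B_sub])
    also have "\<dots> \<le> 64 * real m / \<eta>\<^sup>2"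
      unfolding B_def \<mu>_def by (rule card_swap_lists_deviation[OF n \<eta>])
    finally show "prob U1 \<le> 64 * real m / \<eta>\<^sup>2" .
    show "prob U2 \<le> real (Suc a) / (real L)\<^sup>2" "prob U3 \<le> real (Suc b) / (real L)\<^sup>2"
      unfolding U2_def U3_def using L by (intro ring_time_deviation; simp)+
  qed
  also have "\<dots> \<le> 64 * real m / \<eta>\<^sup>2 + (real m + real L + 1) / (real L)\<^sup>2 + (real m + real L + 1) / (real L)\<^sup>2"
    unfolding b by (intro add_mono divide_right_mono) (auto simp: a_def)
  finally show ?thesis by (simp add: add_divide_distrib)
qed

end

section \<open>The limit\<close>

definition laziness :: "nat \<Rightarrow> real" where
  "laziness n = 4 / real (n - 1)"

definition ring_count :: "(nat \<Rightarrow> real) \<Rightarrow> nat \<Rightarrow> nat" where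
  "ring_count s n = nat \<lfloor>real n * s n\<rfloor>"

definition mean_inversions :: "(nat \<Rightarrow> real) \<Rightarrow> nat \<Rightarrow> real" where
  "mean_inversions s n = walk_mean n (ring_count s n) (\<lambda>\<rho>. real (inversions n \<rho>)) id"

context
  fixes s :: "nat \<Rightarrow> real"
  assumes s_at_top: "filterlim s at_top sequentially"
    and s_small: "(\<lambda>n. s n / real n ^ 2) \<longlonglongrightarrow> 0"
begin

lemma s_eventually_ge: "eventually (\<lambda>n. C \<le> s n) sequentially"
  using s_at_top by (auto simp: filterlim_at_top)

lemma time_at_top: "filterlim (\<lambda>n. real n * s n) at_top sequentially"
  by (rule filterlim_at_top_mult_at_top[OF filterlim_real_sequentially s_at_top])

lemma sqrt_s_at_top: "filterlim (\<lambda>n. sqrt (s n)) at_top sequentially"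
  by (rule filterlim_compose[OF sqrt_at_top s_at_top])

lemma ring_count_ratio: "(\<lambda>n. real (ring_count s n) / (real n * s n)) \<longlonglongrightarrow> 1"
proof -
  have "(\<lambda>n. 1 - 1 / (real n * s n)) \<longlonglongrightarrow> 1 - 0"
    by (intro tendsto_diff tendsto_const tendsto_divide_0[OF tendsto_const] filterlim_at_top_imp_at_infinity
        time_at_top)
  then have lower: "(\<lambda>n. 1 - 1 / (real n * s n)) \<longlonglongrightarrow> 1" by simp
  have pos: "eventually (\<lambda>n. 0 < real n * s n) sequentially"
    using time_at_top by (auto simp: filterlim_at_top_dense)
  show ?thesis
  proof (rule tendsto_sandwich[OF _ _ lower tendsto_const])
    show "\<forall>\<^sub>F n in sequentially. 1 - 1 / (real n * s n) \<le> real (ring_count s n) / (real n * s n)"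
      using pos
    proof eventually_elim
      case (elim n)
      have "real n * s n - 1 \<le> real (ring_count s n)" using elim by (simp add: ring_count_def)
      then have "(real n * s n - 1) / (real n * s n) \<le> real (ring_count s n) / (real n * s n)"
        using elim by (intro divide_right_mono) auto
      moreover have "(x - 1) / x = 1 - 1 / x" if "0 < x" for x :: real
        using that by (simp add: diff_divide_distrib)
      note this[OF elim]
      ultimately show ?case by (simp only:)
    qed
    show "\<forall>\<^sub>F n in sequentially. real (ring_count s n) / (real n * s n) \<le> 1"
      using pos
    proof eventually_elim
      case (elim n)
      have "real (ring_count s n) \<le> real n * s n" using elim by (simp add: ring_count_def)
      then show ?case using elim by (simp add: divide_le_eq_1)
    qed
  qed
qed

text \<open>\<open>laziness n * ring_count s n\<close> is the mean number of moves of the difference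
  walk. It grows like \<open>4 * s n\<close>, which is where the factor 2 comes from.\<close>

lemma jump_count_ratio: "(\<lambda>n. sqrt (laziness n * real (ring_count s n)) / sqrt (s n)) \<longlonglongrightarrow> 2"
proof -
  have "(\<lambda>n. 4 * (real n / (real n - 1))) \<longlonglongrightarrow> 4" by real_asymp
  from tendsto_mult[OF this ring_count_ratio]
  have "(\<lambda>n. sqrt (4 * (real n / (real n - 1)) * (real (ring_count s n) / (real n * s n)))) \<longlonglongrightarrow> sqrt (4 * 1)"
    by (rule tendsto_real_sqrt)
  moreover have "\<forall>\<^sub>F n in sequentially. sqrt
      (4 * (real n / (real n - 1)) * (real (ring_count s n) / (real n * s n)))
      = sqrt (laziness n * real (ring_count s n)) / sqrt (s n)"
    using eventually_ge_at_top[of 2] s_eventually_ge[of 1]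
  proof eventually_elim
    case (elim n)
    then have "4 * (real n / (real n - 1)) * (real (ring_count s n) / (real n * s n))
        = laziness n * real (ring_count s n) / s n"
      by (simp add: laziness_def of_nat_diff divide_simps)
    then show ?case by (simp add: real_sqrt_divide)
  qed
  ultimately show ?thesis by (auto elim: Lim_transform_eventually)
qed

lemma jump_count_at_top: "filterlim (\<lambda>n. sqrt (laziness n * real (ring_count s n))) at_top sequentially"
proof -
  have "filterlim (\<lambda>n. sqrt (laziness n * real (ring_count s n)) / sqrt (s n) * sqrt (s n)) at_top sequentially"
    by (rule filterlim_tendsto_pos_mult_at_top[OF jump_count_ratio _ sqrt_s_at_top]) simp
  moreover have "\<forall>\<^sub>F n in sequentially. sqrt (laziness n * real (ring_count s n)) / sqrt (s n) * sqrt (s n)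
      = sqrt (laziness n * real (ring_count s n))"
    using s_eventually_ge[of 1] by eventually_elim simp
  ultimately show ?thesis by (rule filterlim_mono_eventually[OF _ order_refl order_refl])
qed

lemma walk_abs_ratio:
  "(\<lambda>n. walk_abs (laziness n) (ring_count s n) 0 / sqrt (laziness n * real (ring_count s n))) \<longlonglongrightarrow> sqrt (2 / pi)"
  unfolding tendsto_iff
proof (intro allI impI)
  fix e :: real assume e: "0 < e"
  obtain K where K: "0 \<le> K" "\<And>\<theta> m. 0 < \<theta> \<Longrightarrow> \<theta> \<le> 1 \<Longrightarrow>
    \<bar>walk_abs \<theta> m 0 - sqrt (2 / pi) * sqrt (\<theta> * real m)\<bar> \<le> e / 2 * sqrt (\<theta> * real m) + K"
    using walk_abs_approx[of "e / 2"] e by auto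
  \<comment> \<open>Beyond this threshold the additive error \<open>K\<close> is below the half of
    \<open>e\<close> left over by \<open>walk_abs_approx\<close>.\<close>
  have "\<forall>\<^sub>F n in sequentially. 2 * K / e < sqrt (laziness n * real (ring_count s n))"
    using jump_count_at_top by (auto simp: filterlim_at_top_dense)
  then show "\<forall>\<^sub>F n in sequentially. dist
      (walk_abs (laziness n) (ring_count s n) 0 / sqrt (laziness n * real (ring_count s n))) (sqrt (2 / pi))
      < e"
    using eventually_ge_at_top[of 5]
  proof eventually_elim
    case (elim n)
    define x where "x = sqrt (laziness n * real (ring_count s n))"
    define w where "w = walk_abs (laziness n) (ring_count s n) 0"
    have "0 < laziness n" "laziness n \<le> 1" using elim by (auto simp: laziness_def of_nat_diff)
    from K(2)[OF this, of "ring_count s n"]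
    have w: "\<bar>w - sqrt (2 / pi) * x\<bar> \<le> e / 2 * x + K" by (simp add: w_def x_def)
    have x: "2 * K / e < x" using elim by (simp add: x_def)
    moreover have "0 \<le> 2 * K / e" using K e by simp
    ultimately have x0: "0 < x" by simp
    have "K < e / 2 * x" using x e by (simp add: field_simps)
    with w have "\<bar>w - sqrt (2 / pi) * x\<bar> < e * x" by simp
    moreover have "w / x - sqrt (2 / pi) = (w - sqrt (2 / pi) * x) / x" using x0
        by (simp add: diff_divide_distrib)
    ultimately have "\<bar>w / x - sqrt (2 / pi)\<bar> < e" using x0 by (simp add: abs_divide divide_less_eq)
    then show ?case by (simp add: dist_real_def w_def x_def)
  qed
qed

text \<open>The main term \<open>n / 2 * walk_abs\<close> behaves like
  \<open>n / 2 * sqrt (2 / pi) * 2 * sqrt (s n)\<close>. The remaining error, divided by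
  \<open>n * sqrt (s n)\<close>, is of order \<open>1 / sqrt (s n) + sqrt (s n) / n\<close>: both
  growth conditions on \<open>s\<close> are used here.\<close>

lemma mean_inversions_asymp: "(\<lambda>n. mean_inversions s n / (real n * sqrt (s n))) \<longlonglongrightarrow> sqrt (2 / pi)"
proof -
  define u where "u n = walk_abs (laziness n) (ring_count s n) 0" for n
  define j where "j n = sqrt (laziness n * real (ring_count s n))" for n
  have "(\<lambda>n. u n / j n * (j n / sqrt (s n)) / 2) \<longlonglongrightarrow> sqrt (2 / pi) * 2 / 2"
    unfolding u_def j_def by (intro tendsto_intros walk_abs_ratio jump_count_ratio) simp
  moreover have "\<forall>\<^sub>F n in sequentially. u n / j n * (j n / sqrt (s n)) / 2 = u n / (2 * sqrt (s n))"
    using filterlim_at_top_dense[THEN iffD1, OF jump_count_at_top, rule_format, of 0]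
  proof eventually_elim
    case (elim n)
    then have "0 < j n" by (simp only: j_def)
    then show ?case by simp
  qed
  ultimately have main: "(\<lambda>n. u n / (2 * sqrt (s n))) \<longlonglongrightarrow> sqrt (2 / pi)"
    by (auto elim: Lim_transform_eventually)
  have "(\<lambda>n. 1 / sqrt (s n) + 16 * sqrt (s n / real n ^ 2)) \<longlonglongrightarrow> 0 + 16 * sqrt 0"
    by (intro tendsto_intros s_small tendsto_divide_0[OF tendsto_const] filterlim_at_top_imp_at_infinity
        sqrt_s_at_top)
  then have small: "(\<lambda>n. 1 / sqrt (s n) + 16 * sqrt (s n / real n ^ 2)) \<longlonglongrightarrow> 0" by simp
  have "(\<lambda>n. (mean_inversions s n - real n * u n / 2) / (real n * sqrt (s n))) \<longlonglongrightarrow> 0"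
  proof (rule Lim_null_comparison[OF _ small])
    show "\<forall>\<^sub>F n in sequentially. norm ((mean_inversions s n - real n * u n / 2) / (real n * sqrt (s n)))
        \<le> 1 / sqrt (s n) + 16 * sqrt (s n / real n ^ 2)"
      using eventually_ge_at_top[of 5] s_eventually_ge[of 1]
    proof eventually_elim
      case (elim n)
      define q where "q = sqrt (s n)"
      have q: "q > 0" "s n = q\<^sup>2" using elim by (auto simp: q_def)
      have n: "real n > 0" using elim by simp
      have "laziness n * real (ring_count s n) \<le> laziness n * (real n * s n)"
        using elim by (intro mult_left_mono) (auto simp: laziness_def ring_count_def)
      also have "\<dots> \<le> 8 * s n"
      proof -
        have "laziness n * real n \<le> 8" using elim by (simp add: laziness_def of_nat_diff divide_simps)
        from mult_right_mono[OF this, of "s n"] show ?thesis using elim by (simp add: mult.assoc)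
      qed
      finally have l: "laziness n * real (ring_count s n) \<le> 8 * s n" .
      have "\<bar>mean_inversions s n - real n * u n / 2\<bar> \<le> real n + 2 * (laziness n * real (ring_count s n))"
        using walk_mean_inversions_approx[of n "ring_count s n"] elim
            by (simp add: mean_inversions_def u_def laziness_def)
      also have "\<dots> \<le> real n + 16 * q\<^sup>2" using l q by simp
      finally have "\<bar>mean_inversions s n - real n * u n / 2\<bar> / (real n * q)
          \<le> (real n + 16 * q\<^sup>2) / (real n * q)"
        using q n by (intro divide_right_mono) auto
      also have "\<dots> = 1 / q + 16 * (q / real n)"
        using q n by (simp add: field_simps power2_eq_square)
      finally have bound: "\<bar>mean_inversions s n - real n * u n / 2\<bar> / (real n * q)
          \<le> 1 / q + 16 * (q / real n)" .
      have qn: "sqrt (s n / real n ^ 2) = q / real n"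
        using n unfolding real_sqrt_divide real_sqrt_abs q_def by (simp only: abs_of_pos)
      have "0 < real n * q" using q n by simp
      then show ?case
        unfolding real_norm_def abs_divide qn q_def[symmetric] using bound by (simp only: abs_of_pos)
    qed
  qed
  from tendsto_add[OF this main]
  have "(\<lambda>n. (mean_inversions s n - real n * u n / 2) / (real n * sqrt (s n)) + u n / (2 * sqrt (s n)))
      \<longlonglongrightarrow> sqrt (2 / pi)"
    by simp
  moreover have "\<forall>\<^sub>F n in sequentially. (mean_inversions s n - real n * u n / 2) / (real n * sqrt (s n))
      + u n / (2 * sqrt (s n))
      = mean_inversions s n / (real n * sqrt (s n))"
    using eventually_ge_at_top[of 1] s_eventually_ge[of 1]
    by eventually_elim (simp add: diff_divide_distrib)
  ultimately show ?thesis by (rule Lim_transform_eventually)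
qed

end

theorem theorem4:
  fixes M :: "nat \<Rightarrow> 'a measure"
    and E :: "nat \<Rightarrow> nat \<Rightarrow> 'a \<Rightarrow> real"
    and I :: "nat \<Rightarrow> nat \<Rightarrow> 'a \<Rightarrow> nat"
    and s :: "nat \<Rightarrow> real"
  assumes walk: "\<And>n. 2 \<le> n \<Longrightarrow> adjacent_transposition_clock (M n) n (E n) (I n)"
    and s_pos: "\<And>n. 2 \<le> n \<Longrightarrow> 0 < s n"
    and s_at_top: "filterlim s at_top sequentially"
    and s_small: "(\<lambda>n. s n / real n ^ 2) \<longlonglongrightarrow> 0"
  shows "tendsto_in_probability M
           (\<lambda>n \<omega>. 1 / (real n * sqrt (s n)) * real (walk_distance n (E n) (I n) (real n * s n) \<omega>))
           (sqrt (2 / pi))"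
  unfolding tendsto_in_probability_def
proof (intro allI impI)
  fix \<epsilon> :: real assume \<epsilon>: "0 < \<epsilon>"
  let ?c = "sqrt (2 / pi)"
  let ?W = "\<lambda>n \<omega>. real (walk_distance n (E n) (I n) (real n * s n) \<omega>)"
  \<comment> \<open>The two Chebyshev bounds at the end leave \<open>64 * 16\<close> and
    \<open>2 * 64 * (2 + \<epsilon>)\<close> over \<open>\<epsilon>^2\<close>, times
    \<open>q / D = 1 / n\<close>.\<close>
  define C where "C = 1024 / \<epsilon>\<^sup>2 + 128 * (2 + \<epsilon>) / \<epsilon>\<^sup>2"
  have "(\<lambda>n. C * (1 / real n)) \<longlonglongrightarrow> C * 0"
    by (intro tendsto_intros lim_1_over_n)
  then have lim: "(\<lambda>n. C * (1 / real n)) \<longlonglongrightarrow> 0" by simp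
  show "(\<lambda>n. measure (M n) {\<omega> \<in> space (M n). \<epsilon> < \<bar>1 / (real n * sqrt (s n)) * ?W n \<omega> - ?c\<bar>}) \<longlonglongrightarrow> 0"
  proof (rule Lim_null_comparison[OF _ lim])
    have mean: "\<forall>\<^sub>F n in sequentially. dist (mean_inversions s n / (real n * sqrt (s n))) ?c < \<epsilon> / 4"
      using tendstoD[OF mean_inversions_asymp[OF s_at_top s_small], of "\<epsilon> / 4"] \<epsilon> by simp
    \<comment> \<open>The part \<open>\<epsilon> + 2\<close> will give \<open>L < m\<close>, and
      \<open>8 / \<epsilon>\<close> will make the rounding in \<open>L\<close> harmless.\<close>
    have q_large: "\<forall>\<^sub>F n in sequentially. \<epsilon> + 8 / \<epsilon> + 2 < sqrt (s n)"
      using sqrt_s_at_top[OF s_at_top s_small] by (auto simp: filterlim_at_top_dense)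
    show "\<forall>\<^sub>F n in sequentially. norm (measure (M n)
        {\<omega> \<in> space (M n). \<epsilon> < \<bar>1 / (real n * sqrt (s n)) * ?W n \<omega> - ?c\<bar>}) \<le> C * (1 / real n)"
      using mean q_large eventually_ge_at_top[of 7]
    proof eventually_elim
      case (elim n)
      interpret adjacent_transposition_clock "M n" n "E n" "I n"
        using walk elim by simp
      define q where "q = sqrt (s n)"
      define D where "D = real n * q"
      define m where "m = ring_count s n"
      \<comment> \<open>The tolerated deviation \<open>\<epsilon> * D\<close> is shared out: a
        quarter each for the random swaps (\<open>\<eta>\<close>), the number of rings
        (\<open>L\<close>) and the error of the mean (\<open>dev\<close>). The last quarter is
        slack.\<close>
      define \<eta> where "\<eta> = \<epsilon> / 4 * D"
      define L where "L = nat \<lfloor>\<epsilon> / 4 * D\<rfloor>"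
      have s: "s n = q\<^sup>2" using s_pos[of n] elim by (simp add: q_def)
      have q: "\<epsilon> + 8 / \<epsilon> + 2 < q" using elim by (simp add: q_def)
      have q8: "0 < 8 / \<epsilon>" using \<epsilon> by simp
      have q2: "2 < q" "\<epsilon> + 2 < q" "8 / \<epsilon> < q" using q q8 \<epsilon> by linarith+
      have n: "1 \<le> real n" using elim by simp
      have Dq: "q \<le> D" using n q2 by (simp add: D_def)
      have D: "2 < D" "8 / \<epsilon> < D" using Dq q2 by linarith+
      have \<eta>: "0 < \<eta>" using \<epsilon> D by (simp add: \<eta>_def)
      have D8: "1 < \<epsilon> / 8 * D" using D(2) \<epsilon> by (simp add: field_simps)
      have L_le: "real L \<le> \<epsilon> / 4 * D" and L_gt: "\<epsilon> / 4 * D - 1 < real L"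
        using \<eta> unfolding L_def \<eta>_def by linarith+
      have L_ge: "\<epsilon> / 8 * D \<le> real L" using L_gt D8 by simp
      have L0: "0 < L" using L_ge D8 by (cases L) auto
      have t: "real n * s n = D * q" by (simp add: s D_def power2_eq_square)
      have Dq0: "0 \<le> D * q" using D q2 by simp
      have m: "real m \<le> real n * s n" "real n * s n < real m + 1"
        using Dq0 unfolding m_def ring_count_def t by linarith+
      have "D * (\<epsilon> + 2) \<le> D * q" using D q2 by (intro mult_left_mono) auto
      moreover have "D * (\<epsilon> + 2) = \<epsilon> * D + 2 * D" by (simp add: algebra_simps)
      moreover have "0 < \<epsilon> * D" using D \<epsilon> by simp
      ultimately have "real L < real m" using L_le m D unfolding t by linarith
      then have Lm: "L < m" by simp
      have dev: "\<bar>mean_inversions s n - ?c * D\<bar> < \<epsilon> / 4 * D"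
      proof -
        have "mean_inversions s n - ?c * D = (mean_inversions s n / D - ?c) * D" using D
            by (simp add: left_diff_distrib)
        moreover have "\<bar>mean_inversions s n / D - ?c\<bar> < \<epsilon> / 4" using elim
            by (simp add: dist_real_def D_def q_def)
        ultimately show ?thesis using D by (simp add: abs_mult)
      qed
      have sub: "{\<omega> \<in> space (M n). \<epsilon> < \<bar>1 / (real n * sqrt (s n)) * ?W n \<omega> - ?c\<bar>}
          \<subseteq> {\<omega> \<in> space (M n). \<eta> + real L < \<bar>?W n \<omega> - mean_inversions s n\<bar>}"
      proof clarify
        fix \<omega> assume "\<omega> \<in> space (M n)" and far: "\<epsilon> < \<bar>1 / (real n * sqrt (s n)) * ?W n \<omega> - ?c\<bar>"
        have "?W n \<omega> - ?c * D = (1 / (real n * sqrt (s n)) * ?W n \<omega> - ?c) * D"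
          using D unfolding q_def[symmetric] D_def[symmetric] by (simp add: left_diff_distrib)
        then have "\<bar>?W n \<omega> - ?c * D\<bar> = \<bar>1 / (real n * sqrt (s n)) * ?W n \<omega> - ?c\<bar> * D"
          using D by (simp only: abs_mult)
        moreover have "\<epsilon> * D < \<bar>1 / (real n * sqrt (s n)) * ?W n \<omega> - ?c\<bar> * D" using far D
            by (intro mult_strict_right_mono) auto
        ultimately have "\<epsilon> * D < \<bar>?W n \<omega> - ?c * D\<bar>" by (simp only:)
        moreover have "0 < \<epsilon> * D" using \<epsilon> D by simp
        ultimately show "\<eta> + real L < \<bar>?W n \<omega> - mean_inversions s n\<bar>"
          using dev L_le unfolding \<eta>_def by linarith
      qed
      have "measure (M n) {\<omega> \<in> space (M n). \<epsilon> < \<bar>1 / (real n * sqrt (s n)) * ?W n \<omega> - ?c\<bar>}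
          \<le> 64 * real m / \<eta>\<^sup>2 + 2 * (real m + real L + 1) / (real L)\<^sup>2"
        using elim m Lm L0 \<eta> sub unfolding mean_inversions_def m_def[symmetric]
        by (intro walk_distance_deviation) auto
      \<comment> \<open>\<open>m\<close>, \<open>L\<close> and 1 are bounded by
        \<open>D * q\<close>, \<open>\<epsilon> * (D * q)\<close> and \<open>D * q\<close>, and
        \<open>L\<close> in the denominator is replaced by its lower bound after rounding.\<close>
      also have "\<dots> \<le> 64 * (D * q) / \<eta>\<^sup>2 + 2 * ((2 + \<epsilon>) * (D * q)) / (\<epsilon> / 8 * D)\<^sup>2"
      proof -
        have D1: "D * 1 \<le> D * q" using D q2 by (intro mult_left_mono) auto
        have "\<epsilon> * (D * 1) \<le> \<epsilon> * (D * q)" using \<epsilon> by (intro mult_left_mono D1) simp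
        moreover have "0 < \<epsilon> * D" using \<epsilon> D by simp
        moreover have "(2 + \<epsilon>) * (D * q) = 2 * (D * q) + \<epsilon> * (D * q)" by (simp add: algebra_simps)
        ultimately have "real m + real L + 1 \<le> (2 + \<epsilon>) * (D * q)"
          using m L_le D D1 unfolding t by linarith
        moreover have "(\<epsilon> / 8 * D)\<^sup>2 \<le> (real L)\<^sup>2"
          using L_ge D8 by (intro power_mono) auto
        ultimately show ?thesis
          using m D8 unfolding t by (intro add_mono frac_le divide_right_mono) (auto intro!: zero_less_power)
      qed
      also have "\<dots> = C * (1 / real n)"
        using \<epsilon> n q2 unfolding C_def \<eta>_def D_def by (simp add: field_simps power2_eq_square)
      finally show ?case by simp
    qed
  qed
qed

end
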